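(* Let $\mathrm{CF}(l_1,l_2,l_3)\in\mathfrak{A}_2$ be a two-dimensional algebraic geometric continued fraction and let the one-dimensional subspace $l_1\subset\mathbb{R}^3$ be generated by the vector $(1,\alpha,\beta)$. Then $\mathrm{CF}(l_1,l_2,l_3)$ is palindromic if and only if there exists an algebraic number $\omega$ of degree $3$ over $\mathbb{Q}$, with conjugates $\omega',\omega''$ (so that $\omega,\omega',\omega''$ are the three roots, in some order, of the minimal polynomial of $\omega$), such that at least one of the following conditions holds: (a) $(1,\alpha,\beta)\sim(1,\omega,\omega')$ and $\omega+\omega'+\omega''=0$; (b) $(1,\alpha,\beta)\sim(1,\omega,\omega')$ and $\omega+\omega'+\omega''=1$. Moreover, the existence of such an $\omega$ satisfying (b) is equivalent to the existence of such an $\omega$ satisfying (c), and also equivalent to the existence of such an $\omega$ satisfying (d), where (c) $(1,\alpha,\beta)\sim(1,\omega,1/\omega')$ and $\omega\omega'\omega''=1$; (d) $(1,\alpha,\beta)\sim(1,\omega,-1/\omega')$ and $\omega\omega'\omega''=-1$.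
   Context: An operator $A\in\mathrm{GL}_3(\mathbb{Z})$ (acting on $\mathbb{R}^3$) is called hyperbolic if all its eigenvalues are real and its characteristic polynomial is irreducible over $\mathbb{Q}$. For one-dimensional subspaces $l_1,l_2,l_3$ spanning $\mathbb{R}^3$, the planes spanned by pairs of them divide $\mathbb{R}^3$ into $8$ (closed) simplicial cones with vertex at the origin; the set of these cones is $\mathcal{C}(l_1,l_2,l_3)$. For such a cone $C$ the Klein polyhedron is $\mathcal{K}(C)=\mathrm{conv}(C\cap\mathbb{Z}^3\setminus\{0\})$, and the two-dimensional geometric continued fraction is $\mathrm{CF}(l_1,l_2,l_3)=\bigcup_{C\in\mathcal{C}(l_1,l_2,l_3)}\partial(\mathcal{K}(C))$. It is called algebraic if $l_1,l_2,l_3$ are the eigenspaces of some hyperbolic $A\in\mathrm{GL}_3(\mathbb{Z})$; $\mathfrak{A}_2$ denotes the set of all algebraic two-dimensional geometric continued fractions. A symmetry of $\mathrm{CF}(l_1,l_2,l_3)\in\mathfrak{A}_2$ is an operator $G\in\mathrm{GL}_3(\mathbb{Z})$ mapping $\mathrm{CF}(l_1,l_2,l_3)$ onto itself; equivalently, $G(l_1\cup l_2\cup l_3)=l_1\cup l_2\cup l_3$. It determines a permutation $\sigma_G$ of $\{1,2,3\}$ by $G(l_i)=l_{\sigma_G(i)}$. A symmetry $G$ is called palindromic if $\sigma_G\neq\mathrm{id}$. The continued fraction is called palindromic if it has at least one palindromic symmetry. Two vectors $v_1,v_2\in\mathbb{R}^3$ with first coordinates equal to $1$ are called equivalent, $v_1\sim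 v_2$, if there exist $X\in\mathrm{GL}_3(\mathbb{Z})$ and $\mu\in\mathbb{R}$ such that $Xv_1=\mu v_2$. *)

theory Defs
  imports "HOL-Analysis.Analysis" "HOL-Computational_Algebra.Computational_Algebra"
begin

text \<open>The group \<open>GL\<^sub>n(\<int>)\<close> consists of the matrices that are invertible over the ring of integers.\<close>

definition GL_int :: "(int ^ 'n ^ 'n) set" where
  "GL_int = {A. invertible A}"

definition act :: "int ^ 'n ^ 'n \<Rightarrow> real ^ 'n \<Rightarrow> real ^ 'n" where
  "act A v = map_matrix real_of_int A *v v"

definition charpoly :: "int ^ 'n ^ 'n \<Rightarrow> rat poly" where
  "charpoly A = det (mat [:0, 1:] - map_matrix (\<lambda>a. [:rat_of_int a:]) A)"

text \<open>Eigenvalues are taken over \<open>\<complex>\<close>, so that requiring them to be real is a genuine condition.\<close>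

definition eigenvalue :: "int ^ 'n ^ 'n \<Rightarrow> complex \<Rightarrow> bool" where
  "eigenvalue A \<mu> \<longleftrightarrow> (\<exists>v::complex ^ 'n. v \<noteq> 0 \<and> map_matrix of_int A *v v = \<mu> *s v)"

definition eigenspace :: "int ^ 'n ^ 'n \<Rightarrow> real \<Rightarrow> (real ^ 'n) set" where
  "eigenspace A \<mu> = {v. act A v = \<mu> *\<^sub>R v}"

definition hyperbolic :: "int ^ 3 ^ 3 \<Rightarrow> bool" where
  "hyperbolic A \<longleftrightarrow> A \<in> GL_int \<and> (\<forall>\<mu>. eigenvalue A \<mu> \<longrightarrow> \<mu> \<in> \<real>) \<and> irreducible (charpoly A)"

text \<open>A triple of subspaces is a family indexed by the type \<open>3\<close>, whose elements are
  \<open>1\<close>, \<open>2\<close> and \<open>3\<close>.\<close>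

definition spanning_lines :: "(3 \<Rightarrow> (real ^ 3) set) \<Rightarrow> bool" where
  "spanning_lines l \<longleftrightarrow> (\<forall>i. subspace (l i) \<and> dim (l i) = 1) \<and> span (\<Union>i. l i) = UNIV"

text \<open>The open cones cut out by the three planes are the connected components of the
  complement of their union; the cones themselves are the closures.\<close>

definition cones :: "(3 \<Rightarrow> (real ^ 3) set) \<Rightarrow> (real ^ 3) set set" where
  "cones l = closure ` components (- (\<Union>i. \<Union>j\<in>- {i}. span (l i \<union> l j)))"

definition int_points :: "(real ^ 3) set" where
  "int_points = {v. \<forall>i. v $ i \<in> \<int>}"

definition klein_polyhedron :: "(real ^ 3) set \<Rightarrow> (real ^ 3) set" where
  "klein_polyhedron C = convex hull (C \<inter> int_points - {0})"

definition CF :: "(3 \<Rightarrow> (real ^ 3) set) \<Rightarrow> (real ^ 3) set" where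
  "CF l = (\<Union>C\<in>cones l. frontier (klein_polyhedron C))"

text \<open>Membership of \<open>CF l\<close> in \<open>\<AA>\<^sub>2\<close>. As the \<open>l i\<close> are one-dimensional and span the space,
  they are three different eigenspaces, hence all the eigenspaces of \<open>A\<close>.\<close>

definition algebraic_CF :: "(3 \<Rightarrow> (real ^ 3) set) \<Rightarrow> bool" where
  "algebraic_CF l \<longleftrightarrow>
     spanning_lines l \<and> (\<exists>A. hyperbolic A \<and> (\<forall>i. \<exists>\<mu>. l i = eigenspace A \<mu>))"

definition symmetry_CF :: "(3 \<Rightarrow> (real ^ 3) set) \<Rightarrow> int ^ 3 ^ 3 \<Rightarrow> bool" where
  "symmetry_CF l G \<longleftrightarrow> G \<in> GL_int \<and> act G ` CF l = CF l"

text \<open>The lines \<open>l i\<close> are pairwise different, so the permutation \<open>\<sigma>\<close> below is unique: it is the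
  permutation \<open>\<sigma>\<^sub>G\<close> determined by \<open>G\<close>.\<close>

definition palindromic_symmetry :: "(3 \<Rightarrow> (real ^ 3) set) \<Rightarrow> int ^ 3 ^ 3 \<Rightarrow> bool" where
  "palindromic_symmetry l G \<longleftrightarrow> symmetry_CF l G \<and>
     (\<exists>\<sigma>. \<sigma> permutes UNIV \<and> (\<forall>i. act G ` l i = l (\<sigma> i)) \<and> \<sigma> \<noteq> id)"

definition palindromic_CF :: "(3 \<Rightarrow> (real ^ 3) set) \<Rightarrow> bool" where
  "palindromic_CF l \<longleftrightarrow> (\<exists>G. palindromic_symmetry l G)"

definition vec_equiv :: "real ^ 3 \<Rightarrow> real ^ 3 \<Rightarrow> bool" (infix "\<sim>\<^sub>v" 50) where
  "v \<sim>\<^sub>v w \<longleftrightarrow> v $ 1 = 1 \<and> w $ 1 = 1 \<and> (\<exists>X\<in>GL_int. \<exists>\<mu>::real. act X v = \<mu> *\<^sub>R w)"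

text \<open>\<open>x\<close>, \<open>y\<close>, \<open>z\<close> are the roots of an irreducible rational cubic, which is then the minimal
  polynomial of each of them. Real roots suffice: the equivalence is between real vectors,
  so two of the roots are real, and then so is the third, because the sum of the roots is rational.\<close>

definition cubic_conjugates :: "real \<Rightarrow> real \<Rightarrow> real \<Rightarrow> bool" where
  "cubic_conjugates x y z \<longleftrightarrow>
     (\<exists>p::rat poly. lead_coeff p = 1 \<and> irreducible p \<and> degree p = 3 \<and>
        map_poly of_rat p = [:- x, 1:] * [:- y, 1:] * [:- z, 1:])"

end

theory Submission
  imports Defs
begin

text \<open>Let \<open>v\<^sub>1\<close>, \<open>v\<^sub>2\<close>, \<open>v\<^sub>3\<close> be the eigenvectors with first coordinate \<open>1\<close>. Their coordinates are
  conjugate elements of a cubic field, and an integral linear form that vanishes on one of them is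
  zero (\<open>algebraic_CF_imp_algebraic_lines\<close>, \<open>lin_form_zero\<close>). The field is
  represented by the families \<open>i \<mapsto> x i\<close> of conjugates of its elements; an identity between such families that
  holds at one index holds at all of them (\<open>K_eq\<close>), and this replaces Galois theory throughout.

  From an equivalence to a symmetry. If \<open>v\<^sub>1\<close> is equivalent to \<open>(1, \<omega>, \<omega>')\<close>, then \<open>\<omega>'\<close> lies in
  the field of \<open>\<omega>\<close>, so the field is cyclic and its automorphism rotates \<open>\<omega>\<close>, \<open>\<omega>'\<close>, \<open>\<omega>''\<close>
  (\<open>K_rotate\<close>). As soon as \<open>\<omega> + \<omega>' + \<omega>''\<close> is an integer, this rotation acts on the coordinates
  \<open>(1, \<omega>, \<omega>')\<close> by a unimodular matrix, which is the palindromic symmetry (\<open>palindromic_CF_if_equiv\<close>).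

  From a symmetry to an equivalence. A symmetry that fixes one line multiplies the eigenvector on it by an element of the
  field; by conjugation it fixes every line. Hence a palindromic symmetry \<open>G\<close> permutes the lines
  cyclically, its cube is a scalar \<open>\<plusminus>1\<close>, and up to sign \<open>G\<^sup>3 = 1\<close>
  (\<open>palindromic_symmetry_cube_id\<close>). The lattice of integral linear forms is then a module over the
  group of order \<open>3\<close>. It contains a primitive invariant form \<open>r\<close>, and modulo \<open>r\<close> it is a module
  of rank one over the Eisenstein integers. These are Euclidean, so the quotient is generated by one class,
  that of \<open>u\<close>, and \<open>r\<close>, \<open>u\<close>, \<open>u G\<close> is a basis of the lattice (\<open>exists_rotation_basis\<close>).
  Dividing by \<open>r\<close> gives \<open>v\<^sub>1 \<sim> (1, \<omega>, \<omega>')\<close> with an integral trace of \<open>\<omega>\<close>. Replacing \<open>u\<close> by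
  \<open>\<plusminus>u + n r\<close> changes the trace \<open>S\<close> into \<open>\<plusminus>S + 3n\<close>, so that it can be brought to \<open>0\<close> or \<open>1\<close>
  (\<open>exists_equiv_conjugates\<close>).

  The conditions (b) and (c) are exchanged by \<open>\<omega> \<mapsto> \<omega>'' / \<omega>'\<close> and, in the opposite direction, by solving
  the norm equation explicitly as in Hilbert's Theorem 90 (\<open>equiv_trace_one_imp_norm_one\<close>,
  \<open>equiv_norm_one_imp_trace_one\<close>); (d) is (c) for \<open>- \<omega>\<close>.\<close>

section \<open>Rational cubics and their roots\<close>

text \<open>The symbol \<open>$\<close> is kept for the entries of vectors.\<close>
no_notation fps_nth (infixl "$" 75)

abbreviation rpoly :: "rat poly \<Rightarrow> real \<Rightarrow> real" where
  "rpoly f \<equiv> poly (map_poly of_rat f)"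

lemma rpoly_pCons: "rpoly (pCons a f) t = of_rat a + t * rpoly f t"
  by (simp add: map_poly_pCons)
lemma rpoly_add: "rpoly (f + g) t = rpoly f t + rpoly g t"
proof (induction f arbitrary: g)
  case (pCons a f)
  note IH = pCons.IH
  obtain b h where "g = pCons b h" by (cases g)
  thus ?case by (simp add: rpoly_pCons IH of_rat_add algebra_simps)
qed simp
lemma rpoly_smult: "rpoly (smult c f) t = of_rat c * rpoly f t"
  by (induction f) (simp_all add: rpoly_pCons of_rat_mult algebra_simps)
lemma rpoly_mult: "rpoly (f * g) t = rpoly f t * rpoly g t"
  by (induction f) (simp_all add: rpoly_pCons rpoly_add rpoly_smult algebra_simps)
lemma rpoly_1: "rpoly 1 t = 1" by (simp add: one_pCons rpoly_pCons)

text \<open>A rational polynomial \<open>f\<close> of least degree among those with root \<open>t\<close> divides \<open>p\<close>, which is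
  impossible for an irreducible \<open>p\<close> of larger degree. The descent below is the Euclidean algorithm
  run only for as long as it is needed.\<close>
lemma rpoly_no_common_root:
  assumes "irreducible p" "rpoly p t = 0" "degree f < degree p" "f \<noteq> 0"
  shows "rpoly f t \<noteq> 0"
  using assms(3,4)
proof (induction "degree f" arbitrary: f rule: less_induct)
  case less
  show ?case
  proof
    assume f: "rpoly f t = 0"
    define g where "g = p mod f"
    have p: "p = p div f * f + g" by (simp add: g_def)
    have "rpoly p t = rpoly g t" using f by (subst p) (simp add: rpoly_add rpoly_mult)
    hence "rpoly g t = 0" using assms by simp
    moreover have "g \<noteq> 0 \<Longrightarrow> degree g < degree f"
      using degree_mod_less[OF less.prems(2), of p] by (simp add: g_def)
    ultimately have "g = 0" using less.hyps[of g] less.prems by fastforce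
    hence pf: "p = p div f * f" using p by simp
    have "f dvd 1"
      using irreducibleD[OF assms(1) pf]
    proof
      assume "p div f dvd 1"
      moreover have "p div f \<noteq> 0" using pf less.prems by auto
      ultimately have "degree (p div f) = 0" by (simp add: is_unit_iff_degree)
      hence "degree p = degree f"
        using degree_mult_eq[OF \<open>p div f \<noteq> 0\<close> less.prems(2)] pf by simp
      thus ?thesis using less.prems by simp
    qed
    then obtain k where "1 = f * k" by (elim dvdE)
    hence "rpoly (f * k) t = 1" using rpoly_1 by metis
    thus False by (simp add: rpoly_mult f)
  qed
qed

text \<open>One of the factors of a reducible cubic is linear.\<close>
lemma irreducible_cubic:
  fixes p :: "rat poly"
  assumes "degree p = 3" "\<And>q. poly p q \<noteq> 0"
  shows "irreducible p"
proof (rule irreducibleI)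
  show "p \<noteq> 0" using assms by auto
  show "\<not> is_unit p" using assms by (metis is_unit_iff_degree \<open>p \<noteq> 0\<close> zero_neq_numeral)
next
  fix a b assume p: "p = a * b"
  have "a \<noteq> 0" "b \<noteq> 0" using p assms by auto
  hence d: "degree a + degree b = 3" using p assms degree_mult_eq by metis
  have no: "degree c \<noteq> 1" if "c dvd p" for c
  proof
    assume "degree c = 1"
    then obtain u w where c: "c = [:u, w:]" "w \<noteq> 0" by (metis degree1_coeffs)
    hence "poly c (- u / w) = 0" by simp
    with that have "poly p (- u / w) = 0" by (metis dvdE mult_zero_left poly_mult)
    thus False using assms by blast
  qed
  have "degree a \<noteq> 1" "degree b \<noteq> 1" using no[of a] no[of b] p by auto
  hence "degree a = 0 \<or> degree b = 0" using d by linarith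
  thus "is_unit a \<or> is_unit b" using \<open>a \<noteq> 0\<close> \<open>b \<noteq> 0\<close> by (auto simp: is_unit_iff_degree)
qed

lemma cubic_vieta:
  "[:- x, 1:] * [:- y, 1:] * [:- z, 1::real:] = [:- (x*y*z), x*y+y*z+z*x, - (x+y+z), 1:]"
  by (simp add: algebra_simps)

text \<open>This form of conjugacy is symmetric and mentions no polynomial; all later verifications that
  numbers are conjugate go through it.\<close>
lemma cubic_conjugates_iff:
  "cubic_conjugates x y z \<longleftrightarrow>
     x + y + z \<in> \<rat> \<and> x*y+y*z+z*x \<in> \<rat> \<and> x*y*z \<in> \<rat> \<and> x \<notin> \<rat> \<and> y \<notin> \<rat> \<and> z \<notin> \<rat>"
  (is "?L \<longleftrightarrow> ?R")
proof
  assume ?L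
  then obtain p :: "rat poly" where p: "irreducible p" "degree p = 3"
     "map_poly of_rat p = [:- x, 1:] * [:- y, 1:] * [:- z, 1:]"
    unfolding cubic_conjugates_def by blast
  have c: "of_rat (coeff p k) = coeff [:- (x*y*z), x*y+y*z+z*x, - (x+y+z), 1:] k" for k
    using arg_cong[OF p(3), of "\<lambda>q. coeff q k"] unfolding cubic_vieta by (simp add: coeff_map_poly)
  have "- (x*y*z) \<in> \<rat>" "x*y+y*z+z*x \<in> \<rat>" "- (x+y+z) \<in> \<rat>"
  proof -
    have "- (x*y*z) = of_rat (coeff p 0)" "x*y+y*z+z*x = of_rat (coeff p 1)"
      "- (x+y+z) = of_rat (coeff p 2)"
      using c[of 0] c[of 1] c[of 2] by (simp_all add: numeral_2_eq_2)
    thus "- (x*y*z) \<in> \<rat>" "x*y+y*z+z*x \<in> \<rat>" "- (x+y+z) \<in> \<rat>" by (metis Rats_of_rat)+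
  qed
  moreover have "t \<notin> \<rat>" if "t \<in> {x,y,z}" for t
  proof
    assume "t \<in> \<rat>"
    then obtain q where t: "t = of_rat q" by (auto elim: Rats_cases)
    have "rpoly p t = 0" unfolding p(3) poly_mult using that by auto
    hence "rpoly [:-q, 1:] t \<noteq> 0"
      using rpoly_no_common_root[of p t "[:-q,1:]"] p by simp
    thus False by (simp add: t rpoly_pCons of_rat_minus)
  qed
  ultimately show ?R using Rats_minus_iff by blast
next
  assume R: ?R
  then obtain a b c where abc: "x+y+z = of_rat a" "x*y+y*z+z*x = of_rat b" "x*y*z = of_rat c"
    by (auto elim!: Rats_cases)
  define p where "p = [:-c, b, -a, 1:]"
  have m: "map_poly of_rat p = [:- x, 1:] * [:- y, 1:] * [:- z, 1:]"
    unfolding cubic_vieta p_def by (simp add: map_poly_pCons abc of_rat_minus)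
  have "poly p q \<noteq> 0" for q
  proof
    assume "poly p q = 0"
    hence "of_rat (poly p q) = (0::real)" by simp
    hence "rpoly p (of_rat q) = 0"
      unfolding p_def by (simp add: map_poly_pCons of_rat_add of_rat_mult of_rat_minus of_rat_diff)
    hence "of_rat q \<in> {x,y,z}" unfolding m poly_mult by auto
    thus False using R Rats_of_rat by auto
  qed
  hence "irreducible p" by (intro irreducible_cubic) (auto simp: p_def)
  moreover have "lead_coeff p = 1" "degree p = 3" by (auto simp: p_def)
  ultimately show ?L unfolding cubic_conjugates_def using m by blast
qed

text \<open>The numbers \<open>1\<close>, \<open>x\<close>, \<open>x\<^sup>2\<close> are linearly independent over the rationals. This is the only
  consequence of irreducibility that the arithmetic of the field needs.\<close>
lemma cubic_conjugates_rational_quadratic: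
  assumes "cubic_conjugates x y z" "a \<in> \<rat>" "b \<in> \<rat>" "c \<in> \<rat>" and "a + b * x + c * x^2 = 0"
  shows "a = 0 \<and> b = 0 \<and> c = 0"
proof (rule ccontr)
  obtain p :: "rat poly" where p: "irreducible p" "degree p = 3"
     "map_poly of_rat p = [:- x, 1:] * [:- y, 1:] * [:- z, 1:]"
    using assms unfolding cubic_conjugates_def by blast
  obtain a' b' c' where abc: "a = of_rat a'" "b = of_rat b'" "c = of_rat c'"
    using assms by (auto elim!: Rats_cases)
  assume "\<not> ?thesis"
  hence "[:a',b',c':] \<noteq> 0" using abc by auto
  moreover have "degree [:a',b',c':] < degree p" using p(2) by simp
  moreover have "rpoly p x = 0" unfolding p(3) poly_mult by simp
  ultimately have "rpoly [:a',b',c':] x \<noteq> 0" using rpoly_no_common_root p(1) by blast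
  thus False using assms(5) abc by (simp add: map_poly_pCons power2_eq_square algebra_simps)
qed

lemma cubic_conjugates_commute:
  assumes "cubic_conjugates x y z"
  shows "cubic_conjugates y x z" "cubic_conjugates y z x"
  using assms unfolding cubic_conjugates_iff by (auto simp: algebra_simps)

text \<open>A double root would be a root of the derivative \<open>3X\<^sup>2 - 2e\<^sub>1X + e\<^sub>2\<close>.\<close>
lemma cubic_conjugates_neq:
  assumes "cubic_conjugates x y z"
  shows "x \<noteq> y"
proof
  assume "x = y"
  have e: "x + y + z \<in> \<rat>" "x*y+y*z+z*x \<in> \<rat>"
    using assms unfolding cubic_conjugates_iff by auto
  have "(x*y+y*z+z*x) + (- 2 * (x + y + z)) * x + 3 * x^2 = 0"
    using \<open>x = y\<close> by (simp add: algebra_simps power2_eq_square)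
  with cubic_conjugates_rational_quadratic[OF assms e(2) _ _ this] e(1) show False
    by (metis Rats_mult Rats_minus_iff Rats_number_of zero_neq_numeral)
qed

section \<open>The cubic field as a field of families of conjugates\<close>

text \<open>The cubic field generated by \<open>m 1\<close>, embedded in \<open>\<real>\<^sup>3\<close> by its three embeddings: the entries of a
  member are the values of one rational quadratic polynomial at the three conjugates.\<close>
definition conj_families :: "(3 \<Rightarrow> real) \<Rightarrow> (3 \<Rightarrow> real) set" where
  "conj_families m = {x. \<exists>a\<in>\<rat>. \<exists>b\<in>\<rat>. \<exists>c\<in>\<rat>. \<forall>i. x i = a + b * m i + c * (m i)^2}"

text \<open>Indices live in the type \<open>3\<close>, where addition is modulo \<open>3\<close> and \<open>3 = 0\<close>. A shift \<open>d \<noteq> 0\<close> stands for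
  either of the two cyclic permutations of the indices, so that neither has to be singled out.\<close>
lemma three_arith:
  "(4::3) = 1" "(5::3) = 2" "(6::3) = 3" "(7::3) = 1" "(8::3) = 2" "(9::3) = 3"
  "(10::3) = 1" "(11::3) = 2" "(12::3) = 3"
  by simp_all

lemma orbit_distinct_3:
  fixes d :: 3
  assumes "d \<noteq> 0"
  shows "1 \<noteq> 1 + d" "1 + d \<noteq> 1 + d + d" "1 + d + d \<noteq> 1"
  using assms exhaust_3[of d] by auto

lemma orbit_exhausts_3:
  fixes d :: 3
  assumes "d \<noteq> 0"
  shows "i = 1 \<or> i = 1 + d \<or> i = 1 + d + d"
  using assms exhaust_3[of d] exhaust_3[of i] by auto

lemma add_thrice_3: "i + d + d + d = (i::3)"
  using exhaust_3[of d] exhaust_3[of i] by auto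

locale conjugate_roots =
  fixes m :: "3 \<Rightarrow> real"
  assumes cubic: "cubic_conjugates (m 1) (m 2) (m 3)"
begin

abbreviation "K \<equiv> conj_families m"

lemma K_I: "a \<in> \<rat> \<Longrightarrow> b \<in> \<rat> \<Longrightarrow> c \<in> \<rat> \<Longrightarrow> (\<And>i. x i = a + b * m i + c * (m i)^2) \<Longrightarrow> x \<in> K"
  unfolding conj_families_def by blast

lemma K_E:
  assumes "x \<in> K"
  obtains a b c where "a \<in> \<rat>" "b \<in> \<rat>" "c \<in> \<rat>" "\<And>i. x i = a + b * m i + c * (m i)^2"
  using assms unfolding conj_families_def by blast

lemma K_const: "q \<in> \<rat> \<Longrightarrow> (\<lambda>_. q) \<in> K"
  by (rule K_I[of q 0 0]) auto

lemma K_add: "x \<in> K \<Longrightarrow> y \<in> K \<Longrightarrow> (\<lambda>i. x i + y i) \<in> K"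
proof (elim K_E)
  fix a b c a' b' c'
  assume "a \<in> \<rat>" "b \<in> \<rat>" "c \<in> \<rat>" "a' \<in> \<rat>" "b' \<in> \<rat>" "c' \<in> \<rat>"
    "\<And>i. x i = a + b * m i + c * (m i)\<^sup>2" "\<And>i. y i = a' + b' * m i + c' * (m i)\<^sup>2"
  thus ?thesis by (intro K_I[of "a + a'" "b + b'" "c + c'"]) (auto simp: algebra_simps)
qed

lemma K_scale: "q \<in> \<rat> \<Longrightarrow> x \<in> K \<Longrightarrow> (\<lambda>i. q * x i) \<in> K"
proof (elim K_E)
  fix a b c
  assume "q \<in> \<rat>" "a \<in> \<rat>" "b \<in> \<rat>" "c \<in> \<rat>" "\<And>i. x i = a + b * m i + c * (m i)\<^sup>2"
  thus ?thesis by (intro K_I[of "q * a" "q * b" "q * c"]) (auto simp: algebra_simps)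
qed

lemma K_mult_root:
  assumes "x \<in> K"
  shows "(\<lambda>i. m i * x i) \<in> K"
proof -
  from assms obtain a b c where abc: "a \<in> \<rat>" "b \<in> \<rat>" "c \<in> \<rat>"
    and x: "\<And>i. x i = a + b * m i + c * (m i)^2" by (rule K_E) blast
  define e1 e2 e3 where "e1 = m 1 + m 2 + m 3" and "e2 = m 1 * m 2 + m 2 * m 3 + m 3 * m 1"
    and "e3 = m 1 * m 2 * m 3"
  have e: "e1 \<in> \<rat>" "e2 \<in> \<rat>" "e3 \<in> \<rat>"
    using cubic unfolding cubic_conjugates_iff e1_def e2_def e3_def by auto
  have m3: "m i * (m i * m i) = e3 - e2 * m i + e1 * (m i * m i)" for i
    using exhaust_3[of i] unfolding e1_def e2_def e3_def by (auto simp: algebra_simps)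
  have "m i * x i = a * m i + b * (m i * m i) + c * (m i * (m i * m i))" for i
    unfolding x power2_eq_square by (simp add: algebra_simps)
  hence "m i * x i = c * e3 + (a - c * e2) * m i + (b + c * e1) * (m i)^2" for i
    unfolding m3 power2_eq_square by (simp add: algebra_simps)
  thus ?thesis using abc e by (intro K_I[where x="\<lambda>i. m i * x i"]) auto
qed

lemma K_mult:
  assumes "x \<in> K" "y \<in> K"
  shows "(\<lambda>i. x i * y i) \<in> K"
proof -
  from assms obtain a b c where abc: "a \<in> \<rat>" "b \<in> \<rat>" "c \<in> \<rat>"
    and x: "\<And>i. x i = a + b * m i + c * (m i)^2" by (auto elim: K_E)
  have "(\<lambda>i. (a * y i + b * (m i * y i)) + c * (m i * (m i * y i))) \<in> K"
    by (intro K_add K_scale abc K_mult_root assms)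
  thus ?thesis unfolding x by (simp add: algebra_simps power2_eq_square)
qed

lemma K_uminus: "x \<in> K \<Longrightarrow> (\<lambda>i. - x i) \<in> K"
  using K_scale[of "-1" x] by simp

lemma K_diff: "x \<in> K \<Longrightarrow> y \<in> K \<Longrightarrow> (\<lambda>i. x i - y i) \<in> K"
  using K_add[OF _ K_uminus] by simp

lemma K_sum: "(\<And>j. j \<in> S \<Longrightarrow> x j \<in> K) \<Longrightarrow> (\<lambda>i. \<Sum>j\<in>S. x j i) \<in> K"
  by (induction S rule: infinite_finite_induct) (auto intro: K_add K_const)

lemma cubic_at: "\<exists>y z. cubic_conjugates (m i) y z"
  using exhaust_3[of i] cubic cubic_conjugates_commute by metis

text \<open>All members of a family are values of the same quadratic polynomial, and if this vanishes at one
  root of an irreducible cubic it is zero.\<close>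
lemma K_zero:
  assumes "x \<in> K" "x i = 0"
  shows "x j = 0"
proof -
  from assms obtain a b c where abc: "a \<in> \<rat>" "b \<in> \<rat>" "c \<in> \<rat>"
    and x: "\<And>i. x i = a + b * m i + c * (m i)^2" by (auto elim: K_E)
  obtain y z where "cubic_conjugates (m i) y z" using cubic_at by blast
  from cubic_conjugates_rational_quadratic[OF this abc] x assms(2) show ?thesis by simp
qed

lemma K_eq:
  assumes "x \<in> K" "y \<in> K" "x i = y i"
  shows "x = y"
proof
  fix j show "x j = y j" using K_zero[OF K_diff[OF assms(1,2)], of i j] assms(3) by simp
qed

lemma K_rational:
  assumes "x \<in> K" "x i \<in> \<rat>"
  shows "x j = x i"
  using K_eq[OF assms(1) K_const[OF assms(2)]] by metis

lemma K_trace: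
  assumes "x \<in> K"
  shows "x 1 + x 2 + x 3 \<in> \<rat>"
proof -
  from assms obtain a b c where abc: "a \<in> \<rat>" "b \<in> \<rat>" "c \<in> \<rat>"
    and x: "\<And>i. x i = a + b * m i + c * (m i)^2" by (auto elim: K_E)
  have e: "m 1 + m 2 + m 3 \<in> \<rat>" "m 1 * m 2 + m 2 * m 3 + m 3 * m 1 \<in> \<rat>"
    using cubic unfolding cubic_conjugates_iff by auto
  have "x 1 + x 2 + x 3 = 3 * a + b * (m 1 + m 2 + m 3)
     + c * ((m 1 + m 2 + m 3)^2 - 2 * (m 1 * m 2 + m 2 * m 3 + m 3 * m 1))"
    unfolding x by (simp add: algebra_simps power2_eq_square)
  also have "\<dots> \<in> \<rat>"
    by (intro Rats_add Rats_mult Rats_diff Rats_power abc e Rats_number_of)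
  finally show ?thesis .
qed

text \<open>Newton's identities reduce the other symmetric functions to traces.\<close>
lemma K_symmetric:
  assumes "x \<in> K"
  shows "x 1 * x 2 + x 2 * x 3 + x 3 * x 1 \<in> \<rat>" "x 1 * x 2 * x 3 \<in> \<rat>"
proof -
  define p1 p2 p3 where "p1 = x 1 + x 2 + x 3" and "p2 = x 1 * x 1 + x 2 * x 2 + x 3 * x 3"
    and "p3 = x 1 * (x 1 * x 1) + x 2 * (x 2 * x 2) + x 3 * (x 3 * x 3)"
  have p: "p1 \<in> \<rat>" "p2 \<in> \<rat>" "p3 \<in> \<rat>" unfolding p1_def p2_def p3_def
    using K_trace[OF assms] K_trace[OF K_mult[OF assms assms]]
      K_trace[OF K_mult[OF assms K_mult[OF assms assms]]] by auto
  have "x 1 * x 2 + x 2 * x 3 + x 3 * x 1 = (p1^2 - p2) / 2"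
    "x 1 * x 2 * x 3 = (p1^3 - 3 * p1 * p2 + 2 * p3) / 6"
    unfolding p1_def p2_def p3_def by (simp_all add: field_simps power2_eq_square power3_eq_cube)
  moreover have "(p1^2 - p2) / 2 \<in> \<rat>" "(p1^3 - 3 * p1 * p2 + 2 * p3) / 6 \<in> \<rat>"
    by (intro Rats_divide Rats_add Rats_mult Rats_diff Rats_power p Rats_number_of)+
  ultimately show "x 1 * x 2 + x 2 * x 3 + x 3 * x 1 \<in> \<rat>" "x 1 * x 2 * x 3 \<in> \<rat>"
    by metis+
qed

text \<open>The inverse of a nonzero element is a polynomial in it, by its own cubic equation.\<close>
lemma K_inverse:
  assumes "x \<in> K"
  shows "(\<lambda>i. inverse (x i)) \<in> K"
proof (cases "x 1 = 0")
  case True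
  hence "x = (\<lambda>_. 0)" using K_zero[OF assms] by blast
  thus ?thesis using K_const[of 0] by simp
next
  case False
  hence nz: "x i \<noteq> 0" for i using K_zero[OF assms] by blast
  define e1 e2 e3 where "e1 = x 1 + x 2 + x 3" and "e2 = x 1 * x 2 + x 2 * x 3 + x 3 * x 1"
    and "e3 = x 1 * x 2 * x 3"
  have e: "e1 \<in> \<rat>" "e2 \<in> \<rat>" "e3 \<in> \<rat>"
    using K_symmetric[OF assms] K_trace[OF assms] unfolding e1_def e2_def e3_def by auto
  have "e3 \<noteq> 0" using nz by (simp add: e3_def)
  have "e3 = x i * (x i * x i - e1 * x i + e2)" for i
    using exhaust_3[of i] unfolding e1_def e2_def e3_def by (auto simp: algebra_simps)
  hence "inverse (x i) = inverse e3 * ((x i * x i - e1 * x i) + e2)" for i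
    using nz[of i] \<open>e3 \<noteq> 0\<close> by (simp add: field_simps)
  moreover have "(\<lambda>i. inverse e3 * ((x i * x i - e1 * x i) + e2)) \<in> K"
    using e assms by (intro K_scale K_add K_diff K_mult K_const) auto
  ultimately show ?thesis by simp
qed

lemma K_divide: "x \<in> K \<Longrightarrow> y \<in> K \<Longrightarrow> (\<lambda>i. x i / y i) \<in> K"
  using K_mult[OF _ K_inverse] by (simp add: divide_inverse)

lemma K_cubic_conjugates:
  assumes "x \<in> K" "x i \<notin> \<rat>"
  shows "cubic_conjugates (x 1) (x 2) (x 3)"
proof -
  have "x j \<notin> \<rat>" for j using K_rational[OF assms(1), of j i] assms(2) by metis
  thus ?thesis unfolding cubic_conjugates_iff using K_trace K_symmetric assms(1) by blast
qed

lemma K_inj: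
  assumes "x \<in> K" "x i \<notin> \<rat>" "j \<noteq> k"
  shows "x j \<noteq> x k"
proof -
  note c = K_cubic_conjugates[OF assms(1,2)]
  have "x 1 \<noteq> x 2" "x 2 \<noteq> x 3" "x 3 \<noteq> x 1"
    using c cubic_conjugates_commute cubic_conjugates_neq by metis+
  thus ?thesis using exhaust_3[of j] exhaust_3[of k] assms(3) by metis
qed

text \<open>The cubic equation of \<open>\<omega>\<close> is an identity in the field, hence holds for all entries of the
  family; as these are distinct, they exhaust its roots.\<close>
lemma K_conjugates:
  assumes "x \<in> K" "cubic_conjugates \<omega> \<omega>' \<omega>''" "x 1 = \<omega>"
  obtains d where "d \<noteq> 0" "\<omega>' = x (1 + d)" "\<omega>'' = x (1 + d + d)"
proof -
  define e1 e2 e3 where "e1 = \<omega> + \<omega>' + \<omega>''" and "e2 = \<omega> * \<omega>' + \<omega>' * \<omega>'' + \<omega>'' * \<omega>"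
    and "e3 = \<omega> * \<omega>' * \<omega>''"
  have e: "e1 \<in> \<rat>" "e2 \<in> \<rat>" "e3 \<in> \<rat>" and irr: "x 1 \<notin> \<rat>"
    using assms unfolding cubic_conjugates_iff e1_def e2_def e3_def by auto
  have "(\<lambda>i. x i * (x i * x i) - e1 * (x i * x i) + e2 * x i - e3) \<in> K"
    using e assms by (intro K_scale K_add K_diff K_mult K_const) auto
  moreover have "x i * (x i * x i) - e1 * (x i * x i) + e2 * x i - e3 = (x i - \<omega>) * (x i - \<omega>') * (x i - \<omega>'')" for i
    unfolding e1_def e2_def e3_def by (simp add: algebra_simps)
  ultimately have "(\<lambda>i. (x i - \<omega>) * (x i - \<omega>') * (x i - \<omega>'')) \<in> K" by simp
  from K_zero[OF this, of 1] have "x i \<in> {\<omega>, \<omega>', \<omega>''}" for i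
    using assms(3) by force
  moreover have "x 2 \<noteq> x 1" "x 3 \<noteq> x 1" "x 2 \<noteq> x 3" using K_inj[OF assms(1) irr] by simp_all
  ultimately have "x 2 = \<omega>' \<and> x 3 = \<omega>'' \<or> x 3 = \<omega>' \<and> x 2 = \<omega>''" using assms(3) by (metis empty_iff insert_iff)
  thus ?thesis using that[of 1] that[of 2] by (auto simp: three_arith)
qed

text \<open>If the field contains both \<open>x 1\<close> and its conjugate \<open>x (1 + d)\<close>, then it has an automorphism that takes
  one to the other, and this can only be the rotation: the alternative is that it exchanges
  \<open>x 1\<close> and \<open>x (1 + d)\<close>. It would then fix the third conjugate, which is impossible for an element of
  degree \<open>3\<close>.\<close>
lemma K_rotate:
  assumes "x \<in> K" "x 1 \<notin> \<rat>" "y \<in> K" "y 1 = x (1 + d)" "d \<noteq> 0"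
  shows "y i = x (i + d)"
proof -
  have c: "cubic_conjugates (x (1+d)) (x (1+d+d)) (x 1)"
  proof -
    have c: "cubic_conjugates (x 1) (x 2) (x 3)" by (rule K_cubic_conjugates[OF assms(1,2)])
    have "cubic_conjugates (x 2) (x 3) (x 1)" "cubic_conjugates (x 3) (x 2) (x 1)"
      using cubic_conjugates_commute c by metis+
    thus ?thesis using assms(5) exhaust_3[of d] by (auto simp: three_arith)
  qed
  obtain e where e: "e \<noteq> 0" "x (1+d+d) = y (1+e)" "x 1 = y (1+e+e)"
    by (rule K_conjugates[OF assms(3) c assms(4)])
  show ?thesis
  proof (cases "e = d")
    case True
    have y: "y (1 + d) = x (1 + d + d)" "y (1 + d + d) = x (1 + d + d + d)"
      unfolding add_thrice_3 using e(2,3) True by (simp_all only:)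
    from orbit_exhausts_3[OF assms(5), of i] show ?thesis
      by (elim disjE; hypsubst) (rule assms(4) y)+
  next
    case False
    \<comment> \<open>The transposition: both families have the same entry at the third index.\<close>
    have eq: "1 + e = 1 + d + d" "1 + e + e = 1 + d"
      using exhaust_3[of d] exhaust_3[of e] assms(5) e(1) False by (auto simp: three_arith)
    have y: "x (1+d+d) = y (1+d+d)" "x 1 = y (1+d)" by (rule e(2)[unfolded eq(1)] e(3)[unfolded eq(2)])+
    have "x = y" using K_eq[OF assms(1,3) y(1)] .
    hence "y (1 + d) = x (1 + d)" by (rule fun_cong[OF sym])
    with y(2) have "x 1 = x (1 + d)" by (rule trans)
    thus ?thesis using K_inj[OF assms(1,2) orbit_distinct_3(1)[OF assms(5)]] by (rule notE[rotated])
  qed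
qed

end

section \<open>Unimodular matrices and equivalence of vectors\<close>
lemma map_matrix_mult: "map_matrix real_of_int (A ** B) = map_matrix real_of_int A ** map_matrix real_of_int B"
  by (simp add: vec_eq_iff matrix_matrix_mult_def map_matrix_def)

lemma map_matrix_mat_1: "map_matrix real_of_int (mat 1) = mat 1"
  by (simp add: vec_eq_iff mat_def map_matrix_def)

lemma act_mult: "act (A ** B) v = act A (act B v)"
  by (simp add: act_def map_matrix_mult matrix_vector_mul_assoc)

lemma act_mat_1 [simp]: "act (mat 1) v = v"
  by (simp add: act_def map_matrix_mat_1)

lemma act_linear: "linear (act A)"
  unfolding act_def by (rule matrix_vector_mul_linear)

lemma act_nth: "act A v $ i = (\<Sum>j\<in>UNIV. of_int (A $ i $ j) * v $ j)"
  by (simp add: act_def matrix_vector_mult_def map_matrix_def)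

lemma act_scaleR: "act A (c *\<^sub>R v) = c *\<^sub>R act A v"
  by (rule linear_scale[OF act_linear])

lemma int_left_inverse_commute:
  fixes A B :: "int ^ 'n ^ 'n"
  assumes "A ** B = mat 1"
  shows "B ** A = mat 1"
proof -
  have "map_matrix real_of_int A ** map_matrix real_of_int B = mat 1"
    using assms by (simp flip: map_matrix_mult add: map_matrix_mat_1)
  hence "map_matrix real_of_int (B ** A) = map_matrix real_of_int (mat 1)"
    unfolding map_matrix_mult map_matrix_mat_1 by (simp add: matrix_left_right_inverse)
  thus ?thesis by (simp add: vec_eq_iff map_matrix_def)
qed

lemma GL_intI: "A ** B = mat 1 \<Longrightarrow> A \<in> GL_int"
  unfolding GL_int_def invertible_def using int_left_inverse_commute by blast

lemma GL_intE:
  assumes "A \<in> GL_int"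
  obtains B where "A ** B = mat 1" "B ** A = mat 1" "B \<in> GL_int"
  using assms GL_intI unfolding GL_int_def invertible_def by blast

lemma GL_int_mult: "A \<in> GL_int \<Longrightarrow> B \<in> GL_int \<Longrightarrow> A ** B \<in> GL_int"
  unfolding GL_int_def by (simp add: invertible_mult)

lemma act_inverse: "A ** B = mat 1 \<Longrightarrow> act A (act B v) = v"
  by (simp flip: act_mult)

lemma bij_act:
  assumes "A \<in> GL_int"
  shows "bij (act A)"
proof -
  obtain B where B: "A ** B = mat 1" "B ** A = mat 1" using assms by (rule GL_intE)
  show ?thesis
    by (rule bij_betw_byWitness[where f'="act B"]) (auto simp: act_inverse B)
qed

lemma vec_equiv_trans:
  assumes "u \<sim>\<^sub>v v" "v \<sim>\<^sub>v w"
  shows "u \<sim>\<^sub>v w"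
proof -
  obtain X Y a b where "u $ 1 = 1" "w $ 1 = 1" "X \<in> GL_int" "Y \<in> GL_int"
    "act X u = a *\<^sub>R v" "act Y v = b *\<^sub>R w"
    using assms unfolding vec_equiv_def by blast
  moreover from this have "act (Y ** X) u = (a * b) *\<^sub>R w"
    by (simp add: act_mult act_scaleR)
  ultimately show ?thesis unfolding vec_equiv_def using GL_int_mult by blast
qed

abbreviation mat3 :: "int \<Rightarrow> int \<Rightarrow> int \<Rightarrow> int \<Rightarrow> int \<Rightarrow> int \<Rightarrow> int \<Rightarrow> int \<Rightarrow> int \<Rightarrow> int ^ 3 ^ 3" where
  "mat3 a b c d e f g h k \<equiv> vector [vector [a, b, c], vector [d, e, f], vector [g, h, k]]"

lemma act_mat3:
  "act (mat3 a b c d e f g h k) (vector [x, y, z])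
   = vector [of_int a * x + of_int b * y + of_int c * z,
             of_int d * x + of_int e * y + of_int f * z, of_int g * x + of_int h * y + of_int k * z]"
  by (simp add: vec_eq_iff forall_3 act_nth sum_3)

lemma mat3_mult:
  "mat3 a b c d e f g h k ** mat3 a' b' c' d' e' f' g' h' k' = mat 1 \<longleftrightarrow>
     a * a' + b * d' + c * g' = 1 \<and> a * b' + b * e' + c * h' = 0 \<and> a * c' + b * f' + c * k' = 0 \<and>
     d * a' + e * d' + f * g' = 0 \<and> d * b' + e * e' + f * h' = 1 \<and> d * c' + e * f' + f * k' = 0 \<and>
     g * a' + h * d' + k * g' = 0 \<and> g * b' + h * e' + k * h' = 0 \<and> g * c' + h * f' + k * k' = 1"
  by (simp add: vec_eq_iff forall_3 matrix_matrix_mult_def sum_3 mat_def)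

section \<open>Symmetries of the geometric continued fraction\<close>

text \<open>Everything in the construction of the continued fraction, namely spans, components,
  closures, convex hulls and frontiers, is preserved by linear isomorphisms.\<close>
lemma linear_image_CF:
  fixes f :: "real ^ 3 \<Rightarrow> real ^ 3"
  assumes "linear f" "bij f" "f ` int_points = int_points"
  shows "CF (\<lambda>i. f ` l i) = f ` CF l"
proof -
  have inj: "inj f" using assms(2) by (rule bij_is_inj)
  have surj: "surj f" using assms(2) by (rule bij_is_surj)
  have hom: "homeomorphism S (f ` S) f (inv f)" for S
  proof (rule homeomorphismI)
    show "continuous_on S f" by (rule linear_continuous_on[OF assms(1)[unfolded linear_conv_bounded_linear]])
    show "continuous_on (f ` S) (inv f)"
      using linear_inverse_left[of f] inj_linear_imp_inv_linear[OF assms(1) inj] linear_continuous_on linear_conv_bounded_linear by blast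
  qed (use inj in auto)
  have comp: "components (f ` S) = (`) f ` components S" for S
    unfolding components_def 
    by (simp add: image_image connected_component_set_homeomorphism[OF hom] cong: image_cong)
  have clos: "closure (f ` S) = f ` closure S" for S
    using closure_injective_linear_image[OF assms(1) inj] by metis
  have inter: "interior (f ` S) = f ` interior S" for S
    using interior_injective_linear_image[OF assms(1) inj] by metis
  have fron: "frontier (f ` S) = f ` frontier S" for S
    unfolding frontier_def clos inter using image_set_diff[OF inj] by metis
  have "(\<Union>i. \<Union>j\<in>-{i}. span (f ` l i \<union> f ` l j)) = f ` (\<Union>i. \<Union>j\<in>-{i}. span (l i \<union> l j))"
    by (simp add: image_UN linear_span_image[OF assms(1)] flip: image_Un)
  hence "- (\<Union>i. \<Union>j\<in>-{i}. span (f ` l i \<union> f ` l j)) = f ` (- (\<Union>i. \<Union>j\<in>-{i}. span (l i \<union> l j)))"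
    by (simp only: bij_image_Compl_eq[OF assms(2)])
  hence cones: "cones (\<lambda>i. f ` l i) = (`) f ` cones l"
    unfolding cones_def by (simp add: comp image_image clos)
  have "klein_polyhedron (f ` C) = f ` klein_polyhedron C" for C
  proof -
    have "f ` C \<inter> int_points - {0} = f ` (C \<inter> int_points - {0})"
      using assms(3) linear_0[OF assms(1)] image_set_diff[OF inj] image_Int[OF inj] by (metis image_empty image_insert)
    thus ?thesis unfolding klein_polyhedron_def by (simp add: convex_hull_linear_image[OF assms(1)])
  qed
  thus ?thesis unfolding CF_def cones by (simp add: fron image_UN)
qed

lemma act_int_points:
  assumes "A \<in> GL_int"
  shows "act A ` int_points = int_points"
proof -
  have sub: "act B v \<in> int_points" if "v \<in> int_points" for B v
    using that unfolding int_points_def by (auto simp: act_nth intro!: Ints_sum Ints_mult)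
  obtain B where B: "A ** B = mat 1" using assms by (rule GL_intE)
  show ?thesis
  proof
    show "act A ` int_points \<subseteq> int_points" using sub by blast
    show "int_points \<subseteq> act A ` int_points"
      using sub[of _ B] act_inverse[OF B] by (metis image_eqI subsetI)
  qed
qed

text \<open>The continued fraction depends on the set of lines only, so a unimodular operator that permutes the lines is a symmetry.\<close>
lemma CF_permute:
  assumes "\<sigma> permutes UNIV"
  shows "CF (\<lambda>i. l (\<sigma> i)) = CF l"
proof -
  have "(\<Union>i. \<Union>j\<in>-{i}. span (l (\<sigma> i) \<union> l (\<sigma> j))) = (\<Union>i. \<Union>j\<in>-{i}. span (l i \<union> l j))" (is "?L = ?R")
  proof -
    have s: "bij \<sigma>" using assms by (rule permutes_bij)
    have "?L = (\<Union>i. \<Union>j\<in>\<sigma> ` (-{i}). span (l (\<sigma> i) \<union> l j))" by simp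
    also have "\<dots> = (\<Union>i. \<Union>j\<in>-{\<sigma> i}. span (l (\<sigma> i) \<union> l j))"
      by (simp add: bij_image_Compl_eq[OF s])
    also have "\<dots> = (\<Union>i\<in>range \<sigma>. \<Union>j\<in>-{i}. span (l i \<union> l j))" by simp
    also have "range \<sigma> = UNIV" using s by (rule bij_is_surj)
    finally show ?thesis .
  qed
  thus ?thesis unfolding CF_def cones_def by simp
qed

lemma symmetry_CF_permute:
  assumes "G \<in> GL_int" "\<sigma> permutes UNIV" "\<And>i. act G ` l i = l (\<sigma> i)"
  shows "symmetry_CF l G"
proof -
  have "act G ` CF l = CF (\<lambda>i. act G ` l i)"
    using linear_image_CF[OF act_linear bij_act act_int_points] assms(1) by metis
  also have "\<dots> = CF l" using CF_permute[OF assms(2)] assms(3) by simp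
  finally show ?thesis unfolding symmetry_CF_def using assms(1) by simp
qed

section \<open>The field attached to an algebraic continued fraction\<close>
lemma charpoly_3:
  fixes A :: "int ^ 3 ^ 3"
  shows "charpoly A = [:- of_int (det A),
     of_int (A$1$1 * A$2$2 - A$1$2 * A$2$1 + A$1$1 * A$3$3 - A$1$3 * A$3$1 + A$2$2 * A$3$3 - A$2$3 * A$3$2),
     - of_int (A$1$1 + A$2$2 + A$3$3), 1:]"
  by (simp add: charpoly_def det_3 mat_def map_matrix_def algebra_simps)

lemma mat_mult_vec: "mat k *v x = k *\<^sub>R (x :: real ^ 'n)"
  by (simp add: vec_eq_iff matrix_vector_mult_def mat_def if_distrib[of "\<lambda>x. x * _"] cong: if_cong)

text \<open>What remains of an algebraic continued fraction once its operator is forgotten: generators of the three lines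
  that are conjugate over a cubic field.\<close>
locale algebraic_lines = conjugate_roots m for m +
  fixes v :: "3 \<Rightarrow> real ^ 3"
  assumes v_1: "v i $ 1 = 1"
    and v_K: "(\<lambda>i. v i $ j) \<in> conj_families m"
    and v_det: "det (\<chi> i. v i) \<noteq> 0"

text \<open>Let \<open>u\<close> be an eigenvector for the eigenvalue \<open>\<mu>\<close>. The first coordinates of \<open>u\<close>, \<open>A u\<close>, \<open>A\<^sup>2 u\<close> are
  the first coordinate of \<open>u\<close> times \<open>1\<close>, \<open>\<mu>\<close>, \<open>\<mu>\<^sup>2\<close>. They are obtained from \<open>u\<close> by a rational
  matrix \<open>M\<close>, the same for all eigenvalues. It is invertible, because \<open>1\<close>, \<open>\<mu>\<close>, \<open>\<mu>\<^sup>2\<close> are independent over the rationals,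
  and its inverse expresses the coordinates of \<open>u\<close> as rational quadratic polynomials in \<open>\<mu>\<close>.\<close>
lemma algebraic_CF_imp_algebraic_lines:
  assumes "algebraic_CF l" "l 1 = span {vector [1, \<alpha>, \<beta>]}"
  obtains m v where "algebraic_lines m v" "\<forall>i. l i = span {v i}" "v 1 = vector [1, \<alpha>, \<beta>]"
proof -
  obtain A m where irr: "irreducible (charpoly A)" and l: "\<And>i. l i = eigenspace A (m i)"
    and sub: "\<And>i. subspace (l i)" "\<And>i. dim (l i) = 1" and span: "span (\<Union>i. l i) = UNIV"
    using assms(1) unfolding algebraic_CF_def hyperbolic_def spanning_lines_def by metis
  \<comment> \<open>The generator is chosen as a function of the line, so that equal lines get equal generators.\<close>
  define g :: "(real ^ 3) set \<Rightarrow> real ^ 3" where "g = (\<lambda>L. SOME b. b \<noteq> 0 \<and> L = span {b})"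
  define u where "u = (\<lambda>i. g (l i))"
  have u: "u i \<noteq> 0 \<and> l i = span {u i}" for i
  proof -
    obtain B where B: "B \<subseteq> l i" "independent B" "l i \<subseteq> span B" "card B = dim (l i)"
      using basis_exists by blast
    then obtain b where b: "B = {b}" using sub card_1_singletonE by metis
    have "b \<noteq> 0" using B b dependent_zero by auto
    moreover have "l i = span {b}" using B b sub span_minimal by blast
    ultimately show ?thesis unfolding u_def g_def by (intro someI[of "\<lambda>b. b \<noteq> 0 \<and> l i = span {b}"]) simp
  qed
  have uA: "act A (u i) = m i *\<^sub>R u i" for i
    using u[of i] l[of i] span_base[of "u i" "{u i}"] unfolding eigenspace_def by blast
  have "l i \<subseteq> span (range u)" for i using u[of i] by (metis empty_subsetI insert_subset rangeI span_mono)
  hence "span (range u) = UNIV" using span by (metis UN_least span_minimal subspace_span top.extremum_uniqueI)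
  moreover have "rows (\<chi> i. u i) = range u" by (auto simp: rows_def row_def)
  ultimately have det_u: "det (\<chi> i. u i) \<noteq> 0"
    by (metis matrix_left_invertible_span_rows invertible_det_nz invertible_left_inverse)
  have m_inj: "m i \<noteq> m j" if "i \<noteq> j" for i j
  proof
    assume "m i = m j"
    hence "u i = u j" by (simp add: u_def l)
    hence "det (\<chi> i. u i) = 0" by (intro det_identical_rows[OF that]) (simp add: row_def)
    thus False using det_u by simp
  qed
  define p where "p = charpoly A"
  have deg: "degree p = 3" "lead_coeff p = 1" unfolding p_def charpoly_3 by auto
  have root: "rpoly p (m i) = 0" for i
  proof -
    define B where "B = mat (m i) - map_matrix real_of_int A"
    have "B *v u i = 0" 
      using uA[of i] unfolding B_def act_def
      by (simp add: matrix_vector_mult_diff_rdistrib mat_mult_vec)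
    hence "det B = 0"
      using u[of i] by (metis invertible_det_nz invertible_left_inverse matrix_left_invertible_ker)
    moreover have "rpoly p (m i) = det B"
      unfolding p_def charpoly_3 B_def
      by (simp add: det_3 mat_def map_matrix_def map_poly_pCons of_rat_minus of_rat_add of_rat_diff of_rat_mult algebra_simps)
    ultimately show ?thesis by simp
  qed
  have cubic: "cubic_conjugates (m 1) (m 2) (m 3)"
  proof -
    have "map_poly of_rat p = [:- m 1, 1:] * [:- m 2, 1:] * [:- m 3, 1:]"
    proof (rule poly_eqI_degree_lead_coeff[where A="{m 1, m 2, m 3}" and n=3])
      show "3 \<le> card {m 1, m 2, m 3}" using m_inj by simp
      show "coeff (map_poly real_of_rat p) 3 = coeff ([:- m 1, 1:] * [:- m 2, 1:] * [:- m 3, 1:]) 3"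
        using deg unfolding cubic_vieta by (simp add: coeff_map_poly numeral_3_eq_3)
      show "degree (map_poly real_of_rat p) \<le> 3" using deg by (simp add: degree_map_poly)
      show "degree ([:- m 1, 1:] * [:- m 2, 1:] * [:- m 3, 1:]) \<le> 3" unfolding cubic_vieta by simp
      show "rpoly p z = poly ([:- m 1, 1:] * [:- m 2, 1:] * [:- m 3, 1:]) z"
        if "z \<in> {m 1, m 2, m 3}" for z unfolding poly_mult using that root by auto
    qed
    thus ?thesis unfolding cubic_conjugates_def using deg irr p_def by blast
  qed
  interpret conjugate_roots m by unfold_locales (rule cubic)
  have u1: "u 1 $ 1 \<noteq> 0"
  proof -
    have "vector [1, \<alpha>, \<beta>] \<in> l 1" unfolding assms(2) by (simp add: span_base)
    hence "vector [1, \<alpha>, \<beta>] \<in> span {u 1}" using u[of 1] by simp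
    then obtain k where "vector [1, \<alpha>, \<beta>] = k *\<^sub>R u 1" by (auto simp: span_singleton)
    hence "(1::real) = k * u 1 $ 1" by (simp add: vec_eq_iff forall_3)
    thus ?thesis by auto
  qed
  define M :: "rat ^ 3 ^ 3" where
    "M = vector [axis 1 1, \<chi> j. of_int (A $ 1 $ j), \<chi> j. of_int ((A ** A) $ 1 $ j)]"
  define y where "y i k = (\<Sum>j\<in>UNIV. of_rat (M $ k $ j) * u i $ j)" for i k
  have y: "(\<Sum>j\<in>UNIV. of_rat (M $ 1 $ j) * u i $ j) = u i $ 1"
    "(\<Sum>j\<in>UNIV. of_rat (M $ 2 $ j) * u i $ j) = m i * u i $ 1"
    "(\<Sum>j\<in>UNIV. of_rat (M $ 3 $ j) * u i $ j) = (m i)^2 * u i $ 1" for i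
  proof -
    show "(\<Sum>j\<in>UNIV. of_rat (M $ 1 $ j) * u i $ j) = u i $ 1"
      unfolding M_def by (simp add: sum_3 axis_def)
    have "(\<Sum>j\<in>UNIV. of_rat (M $ 2 $ j) * u i $ j) = act A (u i) $ 1"
      unfolding M_def by (simp add: act_nth)
    thus "(\<Sum>j\<in>UNIV. of_rat (M $ 2 $ j) * u i $ j) = m i * u i $ 1" by (simp add: uA)
    have "(\<Sum>j\<in>UNIV. of_rat (M $ 3 $ j) * u i $ j) = act (A ** A) (u i) $ 1"
      unfolding M_def by (simp add: act_nth)
    thus "(\<Sum>j\<in>UNIV. of_rat (M $ 3 $ j) * u i $ j) = (m i)^2 * u i $ 1"
      by (simp add: act_mult uA act_scaleR power2_eq_square)
  qed
  note y = y[folded y_def]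
  have "\<exists>N. N ** M = mat 1"
  proof -
    have "c = 0" if "c v* M = 0" for c
    proof -
      have col: "(\<Sum>k\<in>UNIV. of_rat (c $ k) * of_rat (M $ k $ j)) = (0::real)" for j
      proof -
        have "of_rat ((c v* M) $ j) = (0::real)" using that by simp
        thus ?thesis by (simp add: vector_matrix_mult_def of_rat_sum of_rat_mult mult.commute)
      qed
      have "0 = (\<Sum>j\<in>UNIV. (\<Sum>k\<in>UNIV. of_rat (c $ k) * of_rat (M $ k $ j)) * u 1 $ j)"
        by (simp add: col)
      also have "\<dots> = (\<Sum>k\<in>UNIV. of_rat (c $ k) * y 1 k)"
        unfolding y_def by (subst sum_distrib_right, subst sum.swap) (simp add: sum_distrib_left mult.assoc)
      also have "\<dots> = (of_rat (c $ 1) + of_rat (c $ 2) * m 1 + of_rat (c $ 3) * (m 1)^2) * u 1 $ 1"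
        by (simp only: sum_3 y) (simp add: algebra_simps)
      finally have "of_rat (c $ 1) + of_rat (c $ 2) * m 1 + of_rat (c $ 3) * (m 1)^2 = 0"
        using u1 by simp
      from cubic_conjugates_rational_quadratic[OF cubic _ _ _ this] show "c = 0"
        by (simp add: vec_eq_iff forall_3)
    qed
    hence "\<forall>x. transpose M *v x = 0 \<longrightarrow> x = 0" by (simp add: flip: vector_transpose_matrix)
    hence "\<exists>B. B ** transpose M = mat 1" by (rule matrix_left_invertible_ker[THEN iffD2])
    then obtain B where "B ** transpose M = mat 1" ..
    hence "transpose M ** B = mat 1" by (rule matrix_left_right_inverse[THEN iffD1])
    hence "transpose B ** M = mat 1" by (metis matrix_transpose_mul transpose_mat transpose_transpose)
    thus ?thesis by blast
  qed
  then obtain N where N: "N ** M = mat 1" by blast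
  have uj: "u i $ j = (of_rat (N $ j $ 1) + of_rat (N $ j $ 2) * m i + of_rat (N $ j $ 3) * (m i)^2) * u i $ 1" for i j
  proof -
    have col: "(\<Sum>k\<in>UNIV. of_rat (N $ j $ k) * of_rat (M $ k $ h)) = (if j = h then 1 else 0 :: real)" for h
    proof -
      have "of_rat ((N ** M) $ j $ h) = (if j = h then 1 else 0 :: real)" unfolding N by (simp add: mat_def)
      thus ?thesis by (simp add: matrix_matrix_mult_def of_rat_sum of_rat_mult)
    qed
    have "u i $ j = (\<Sum>h\<in>UNIV. (if j = h then 1 else 0) * u i $ h)" by (simp add: if_distrib[of "\<lambda>x. x * _"] cong: if_cong)
    also have "\<dots> = (\<Sum>h\<in>UNIV. (\<Sum>k\<in>UNIV. of_rat (N $ j $ k) * of_rat (M $ k $ h)) * u i $ h)" by (simp add: col)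
    also have "\<dots> = (\<Sum>k\<in>UNIV. of_rat (N $ j $ k) * y i k)"
      unfolding y_def by (subst sum_distrib_right, subst sum.swap) (simp add: sum_distrib_left mult.assoc)
    also have "\<dots> = (of_rat (N $ j $ 1) + of_rat (N $ j $ 2) * m i + of_rat (N $ j $ 3) * (m i)^2) * u i $ 1"
      by (simp only: sum_3 y) (simp add: algebra_simps)
    finally show ?thesis .
  qed
  have ui1: "u i $ 1 \<noteq> 0" for i
  proof
    assume "u i $ 1 = 0"
    hence "u i $ j = 0" for j using uj[of i j] by simp
    thus False using u[of i] by (simp add: vec_eq_iff)
  qed
  define v where "v = (\<lambda>i. inverse (u i $ 1) *\<^sub>R u i)"
  have "algebraic_lines m v"
  proof
    show "v i $ 1 = 1" for i unfolding v_def using ui1 by simp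
    show "(\<lambda>i. v i $ j) \<in> conj_families m" for j
    proof (rule K_I)
      show "v i $ j = of_rat (N $ j $ 1) + of_rat (N $ j $ 2) * m i + of_rat (N $ j $ 3) * (m i)^2" for i
        using uj[of i j] ui1[of i] unfolding v_def by (simp add: field_simps)
    qed auto
    have "det (\<chi> i. v i) = prod (\<lambda>i. inverse (u i $ 1)) UNIV * det (\<chi> i. u i)"
      unfolding v_def scalar_mult_eq_scaleR[symmetric] by (rule det_rows_mul)
    thus "det (\<chi> i. v i) \<noteq> 0" using det_u ui1 by (simp add: prod_zero_iff)
  qed
  moreover have lv: "l i = span {v i}" for i
  proof -
    have "u i = (u i $ 1) *\<^sub>R v i" using ui1[of i] by (simp add: v_def)
    hence "u i \<in> span {v i}" by (metis span_base span_scale singletonI)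
    moreover have "v i \<in> span {u i}" by (simp add: v_def span_base span_scale)
    ultimately have "span {v i} = span {u i}" by (simp add: span_eq)
    thus ?thesis using u[of i] by simp
  qed
  moreover have "v 1 = vector [1, \<alpha>, \<beta>]"
  proof -
    have "v 1 \<in> l 1" unfolding lv by (simp add: span_base)
    hence "v 1 \<in> span {vector [1, \<alpha>, \<beta>]}" unfolding assms(2) .
    then obtain k where k: "v 1 = k *\<^sub>R vector [1, \<alpha>, \<beta>]" by (auto simp: span_singleton)
    hence "v 1 $ 1 = k" by simp
    moreover have "v 1 $ 1 = 1" unfolding v_def using ui1 by simp
    ultimately show ?thesis using k by simp
  qed
  ultimately show ?thesis using that by blast
qed

section \<open>Integral linear forms on the eigenvectors\<close>
definition lin_form :: "int ^ 'n \<Rightarrow> real ^ 'n \<Rightarrow> real" where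
  "lin_form r u = (\<Sum>j\<in>UNIV. of_int (r $ j) * u $ j)"

lemma act_nth_lin_form: "act X u $ j = lin_form (X $ j) u"
  by (simp add: act_nth lin_form_def)

lemma lin_form_add: "lin_form (r + s) u = lin_form r u + lin_form s u"
  by (simp add: lin_form_def sum.distrib algebra_simps)

lemma lin_form_diff: "lin_form (r - s) u = lin_form r u - lin_form s u"
  by (simp add: lin_form_def sum_subtractf algebra_simps)

lemma lin_form_scaleR: "lin_form r (c *\<^sub>R u) = c * lin_form r u"
  by (simp add: lin_form_def sum_distrib_left algebra_simps)

lemma lin_form_smult: "lin_form (k *s r) u = of_int k * lin_form r u"
  by (simp add: lin_form_def sum_distrib_left algebra_simps)

lemma lin_form_axis: "lin_form (axis j 1) u = u $ j"
  by (simp add: lin_form_def axis_def if_distrib[of of_int] if_distrib[of "\<lambda>x. x * _"] cong: if_cong)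

lemma lin_form_vector_matrix: "lin_form (r v* X) u = lin_form r (act X u)"
proof -
  have "lin_form (r v* X) u = (\<Sum>j\<in>UNIV. \<Sum>i\<in>UNIV. of_int (r $ i) * of_int (X $ i $ j) * u $ j)"
    by (simp add: lin_form_def vector_matrix_mult_def sum_distrib_left algebra_simps)
  also have "\<dots> = lin_form r (act X u)"
    by (subst sum.swap) (simp add: lin_form_def act_nth sum_distrib_left mult.assoc)
  finally show ?thesis .
qed

lemma vec_equivI:
  assumes "A ** B = mat 1" "act A (vector [1, a, b] :: real ^ 3) = c *\<^sub>R vector [1, a', b']"
  shows "vector [1, a, b] \<sim>\<^sub>v vector [1, a', b']"
  using assms GL_intI unfolding vec_equiv_def by auto

lemma sum3_shift:
  fixes d :: 3 and x :: "3 \<Rightarrow> real"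
  assumes "d \<noteq> 0"
  shows "x i + x (i + d) + x (i + d + d) = x 1 + x 2 + x 3"
  using assms exhaust_3[of d] exhaust_3[of i] by (auto simp: three_arith)

lemma prod3_shift:
  fixes d :: 3 and x :: "3 \<Rightarrow> real"
  assumes "d \<noteq> 0"
  shows "x i * x (i + d) * x (i + d + d) = x 1 * x 2 * x 3"
  using assms exhaust_3[of d] exhaust_3[of i] by (auto simp: three_arith)

lemma permutes_shift: "(\<lambda>i. i + d) permutes (UNIV :: 3 set)"
proof -
  have "\<exists>!x. x + d = y" for y by (rule ex1I[of _ "y - d"]) auto
  thus ?thesis by (auto simp: permutes_def)
qed

context conjugate_roots
begin

lemma K_cubic_conjugates_shift:
  assumes "x \<in> K" "x i \<notin> \<rat>" "d \<noteq> 0"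
  shows "cubic_conjugates (x i) (x (i + d)) (x (i + d + d))"
proof -
  have c: "cubic_conjugates (x 1) (x 2) (x 3)" by (rule K_cubic_conjugates[OF assms(1,2)])
  have "cubic_conjugates (x 2) (x 3) (x 1)" "cubic_conjugates (x 3) (x 2) (x 1)"
    "cubic_conjugates (x 1) (x 3) (x 2)" "cubic_conjugates (x 2) (x 1) (x 3)" "cubic_conjugates (x 3) (x 1) (x 2)"
    using cubic_conjugates_commute c by metis+
  thus ?thesis using c assms(3) exhaust_3[of d] exhaust_3[of i] by (auto simp: three_arith)
qed

end

context algebraic_lines
begin

lemma real_row_zero:
  assumes "\<And>i. (\<Sum>j\<in>UNIV. r $ j * v i $ j) = 0"
  shows "r = 0"
proof -
  have "(\<chi> i. v i) *v r = 0"
    using assms by (simp add: vec_eq_iff matrix_vector_mult_def mult.commute)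
  moreover have "\<exists>B. B ** (\<chi> i. v i) = mat 1"
    using v_det by (metis invertible_det_nz invertible_left_inverse)
  ultimately show ?thesis using matrix_left_invertible_ker[THEN iffD1] by metis
qed

lemma lin_form_K: "(\<lambda>i. lin_form r (v i)) \<in> K"
  unfolding lin_form_def by (intro K_sum K_scale v_K) auto

text \<open>The values of the form on the three vectors are conjugate, so they vanish together, and the vectors span the
  space.\<close>
lemma lin_form_zero:
  assumes "lin_form r (v i) = 0"
  shows "r = 0"
proof -
  have "lin_form r (v k) = 0" for k using K_zero[OF lin_form_K assms] .
  hence "(\<chi> j. real_of_int (r $ j)) = 0" unfolding lin_form_def by (intro real_row_zero) simp
  thus ?thesis by (simp add: vec_eq_iff)
qed

lemma lin_form_eqI: "lin_form r (v i) = lin_form s (v i) \<Longrightarrow> r = s"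
  using lin_form_zero[of "r - s" i] by (simp add: lin_form_diff)

lemma GL_int_act_nonzero:
  assumes "X \<in> GL_int"
  shows "act X (v i) $ j \<noteq> 0"
proof
  assume "act X (v i) $ j = 0"
  hence "X $ j = 0" unfolding act_nth_lin_form by (rule lin_form_zero)
  moreover obtain B where "X ** B = mat 1" using assms by (rule GL_intE)
  ultimately have "(mat 1 :: int ^ 3 ^ 3) $ j $ j = 0"
    by (metis (no_types, lifting) matrix_matrix_mult_def mult_zero_left sum.neutral vec_lambda_beta zero_index)
  thus False by (simp add: mat_def)
qed

text \<open>An equivalence of \<open>v 1\<close> with \<open>(1, a, b)\<close> puts \<open>a\<close> and \<open>b\<close> in the field, and the same matrix
  takes the conjugate vectors to multiples of the conjugates of \<open>(1, a, b)\<close>.\<close>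
lemma vec_equivE:
  assumes "v 1 \<sim>\<^sub>v vector [1, a, b]"
  obtains X x y c where "X \<in> GL_int" "x \<in> K" "y \<in> K" "x 1 = a" "y 1 = b"
    "\<forall>i. c i \<noteq> 0" "\<forall>i. act X (v i) = c i *\<^sub>R vector [1, x i, y i]"
proof -
  obtain X \<mu> where X: "X \<in> GL_int" and \<mu>: "act X (v 1) = \<mu> *\<^sub>R vector [1, a, b]"
    using assms unfolding vec_equiv_def by blast
  define c x y where "c i = act X (v i) $ 1" and "x i = act X (v i) $ 2 / c i"
    and "y i = act X (v i) $ 3 / c i" for i
  have c: "c i \<noteq> 0" for i unfolding c_def by (rule GL_int_act_nonzero[OF X])
  have "c 1 = \<mu>" unfolding c_def \<mu> by simp
  hence "x 1 = a" "y 1 = b" using c[of 1] unfolding x_def y_def \<mu> by simp_all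
  moreover have "x \<in> K" "y \<in> K" unfolding x_def[abs_def] y_def[abs_def] c_def act_nth_lin_form
    by (intro K_divide lin_form_K)+
  moreover have "act X (v i) = c i *\<^sub>R vector [1, x i, y i]" for i
    using c[of i] by (simp add: vec_eq_iff forall_3 x_def y_def) (simp add: c_def)
  ultimately show ?thesis using that X c by blast
qed

section \<open>Equivalences that produce palindromic symmetries\<close>

text \<open>As \<open>\<omega>'' = k - \<omega> - \<omega>'\<close>, the integral matrix \<open>P\<close> below takes \<open>(1, \<omega>, \<omega>')\<close> to \<open>(1, \<omega>', \<omega>'')\<close>, and it
  does the same to the conjugates of these vectors. In the original coordinates it rotates the lines.\<close>
lemma palindromic_CF_if_equiv:
  assumes l: "\<And>i. l i = span {v i}"
    and cubic': "cubic_conjugates \<omega> \<omega>' \<omega>''" and equiv: "v 1 \<sim>\<^sub>v vector [1, \<omega>, \<omega>']"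
    and sum: "\<omega> + \<omega>' + \<omega>'' = of_int k"
  shows "palindromic_CF l"
proof -
  obtain X x y c where X: "X \<in> GL_int" and xy: "x \<in> K" "y \<in> K" "x 1 = \<omega>" "y 1 = \<omega>'"
    and c': "\<forall>i. c i \<noteq> 0" and Xv': "\<forall>i. act X (v i) = c i *\<^sub>R vector [1, x i, y i]"
    using equiv by (rule vec_equivE)
  note c = c'[rule_format] and Xv = Xv'[rule_format] 
  obtain d where d: "d \<noteq> 0" "\<omega>' = x (1 + d)" "\<omega>'' = x (1 + d + d)"
    using xy(1) cubic' xy(3) by (rule K_conjugates)
  have irr: "x 1 \<notin> \<rat>" using cubic' xy(3) unfolding cubic_conjugates_iff by simp
  have y: "y i = x (i + d)" for i
    using K_rotate[OF xy(1) irr xy(2) _ d(1)] xy(4) d(2) by simp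
  have s: "x i + x (i + d) + x (i + d + d) = of_int k" for i
    using sum3_shift[OF d(1), of x i] sum3_shift[OF d(1), of x 1] sum d xy(3) by simp
  obtain B where B: "X ** B = mat 1" "B ** X = mat 1" "B \<in> GL_int" using X by (rule GL_intE)
  define P :: "int ^ 3 ^ 3" where "P = mat3 1 0 0 0 0 1 k (-1) (-1)"
  define P' :: "int ^ 3 ^ 3" where "P' = mat3 1 0 0 k (-1) (-1) 0 1 0"
  have "P ** P' = mat 1" unfolding P_def P'_def
    by (simp add: mat3_mult)
  hence P: "P \<in> GL_int" by (rule GL_intI)
  define G where "G = B ** (P ** X)"
  have G: "G \<in> GL_int" unfolding G_def by (intro GL_int_mult B P X)
  have Gv: "act G (v i) = (c i / c (i + d)) *\<^sub>R v (i + d)" for i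
  proof -
    have *: "act G (v i) = c i *\<^sub>R act B (act P (vector [1, x i, y i]))"
      by (simp only: G_def act_mult Xv act_scaleR)
    have "act P (vector [1, x i, y i]) = vector [1, x (i + d), y (i + d)]"
      unfolding P_def act_mat3 y using s[of i] by (simp add: vec_eq_iff forall_3)
    also have "\<dots> = inverse (c (i + d)) *\<^sub>R act X (v (i + d))" unfolding Xv using c by simp
    finally show ?thesis
      by (simp only: * act_scaleR act_inverse[OF B(2)] divide_inverse scaleR_scaleR)
  qed
  have "act G ` l i = l (i + d)" for i
  proof -
    have "act G ` l i = span {act G (v i)}"
      unfolding l by (simp add: linear_span_image[OF act_linear, symmetric])
    also have "\<dots> = span {v (i + d)}"
    proof -
      have nz: "c i / c (i + d) \<noteq> 0" using c by simp
      have "v (i + d) = inverse (c i / c (i + d)) *\<^sub>R act G (v i)" unfolding Gv using nz by simp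
      hence "v (i + d) \<in> span {act G (v i)}" by (metis span_base span_scale singletonI)
      moreover have "act G (v i) \<in> span {v (i + d)}" unfolding Gv by (simp add: span_base span_scale)
      ultimately show ?thesis by (simp add: span_eq)
    qed
    finally show ?thesis unfolding l .
  qed
  moreover have "(\<lambda>i. i + d) \<noteq> id" using d(1) by (auto simp: fun_eq_iff)
  ultimately show ?thesis
    unfolding palindromic_CF_def palindromic_symmetry_def
    using symmetry_CF_permute[OF G permutes_shift] permutes_shift by blast
qed

section \<open>The conditions on the trace and on the norm\<close>

text \<open>The quotients of consecutive conjugates have product \<open>1\<close>. Dividing \<open>(\<omega>', \<omega>'', \<omega>)\<close>, which arises
  unimodularly from \<open>(1, \<omega>, \<omega>')\<close> because the trace is \<open>1\<close>, by \<open>\<omega>'\<close> gives the new vector.\<close>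
lemma equiv_trace_one_imp_norm_one:
  assumes cubic': "cubic_conjugates \<omega> \<omega>' \<omega>''" and equiv: "v 1 \<sim>\<^sub>v vector [1, \<omega>, \<omega>']"
    and sum: "\<omega> + \<omega>' + \<omega>'' = 1"
  shows "cubic_conjugates (\<omega>'' / \<omega>') (\<omega>' / \<omega>) (\<omega> / \<omega>'')"
    and "v 1 \<sim>\<^sub>v vector [1, \<omega>'' / \<omega>', 1 / (\<omega>' / \<omega>)]"
    and "(\<omega>'' / \<omega>') * (\<omega>' / \<omega>) * (\<omega> / \<omega>'') = 1"
proof -
  obtain X x y c where X: "X \<in> GL_int" and xy: "x \<in> K" "y \<in> K" "x 1 = \<omega>" "y 1 = \<omega>'"
    and c': "\<forall>i. c i \<noteq> 0" and Xv': "\<forall>i. act X (v i) = c i *\<^sub>R vector [1, x i, y i]"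
    using equiv by (rule vec_equivE)
  note c = c'[rule_format] and Xv = Xv'[rule_format] 
  obtain d where d: "d \<noteq> 0" "\<omega>' = x (1 + d)" "\<omega>'' = x (1 + d + d)"
    using xy(1) cubic' xy(3) by (rule K_conjugates)
  have irr: "x 1 \<notin> \<rat>" using cubic' xy(3) unfolding cubic_conjugates_iff by simp
  have y: "y i = x (i + d)" for i
    using K_rotate[OF xy(1) irr xy(2) _ d(1)] xy(4) d(2) by simp
  have nz: "\<omega> \<noteq> 0" "\<omega>' \<noteq> 0" "\<omega>'' \<noteq> 0" using cubic' unfolding cubic_conjugates_iff by auto
  show prod: "(\<omega>'' / \<omega>') * (\<omega>' / \<omega>) * (\<omega> / \<omega>'') = 1" using nz by simp
  define z where "z i = y i / x i" for i
  have zK: "z \<in> K" unfolding z_def[abs_def] by (intro K_divide xy)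
  have z: "z 1 = \<omega>' / \<omega>" "z (1 + d) = \<omega>'' / \<omega>'" "z (1 + d + d) = \<omega> / \<omega>''"
    unfolding z_def y add_thrice_3 d xy(3)[symmetric] by simp_all
  have "z 1 \<notin> \<rat>"
  proof
    assume "z 1 \<in> \<rat>"
    hence "z (1 + d) = z 1" "z (1 + d + d) = z 1" by (rule K_rational[OF zK])+
    hence "z 1 * z 1 * z 1 = 1" using prod unfolding z[symmetric] by simp
    hence "z 1 ^ 3 = 1 ^ 3" by (simp add: power3_eq_cube)
    hence "z 1 = 1" using odd_real_root_power_cancel[of 3] by (metis odd_numeral)
    hence "\<omega>' = \<omega>" using nz z(1) by simp
    thus False using cubic_conjugates_neq[OF cubic'] by simp
  qed
  hence "cubic_conjugates (z 1) (z (1 + d)) (z (1 + d + d))"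
    by (rule K_cubic_conjugates_shift[OF zK _ d(1)])
  thus "cubic_conjugates (\<omega>'' / \<omega>') (\<omega>' / \<omega>) (\<omega> / \<omega>'')"
    unfolding z by (rule cubic_conjugates_commute(1))
  have "vector [1, \<omega>, \<omega>'] \<sim>\<^sub>v vector [1, \<omega>'' / \<omega>', 1 / (\<omega>' / \<omega>)]"
  proof (rule vec_equivI)
    show "mat3 0 0 1 1 (-1) (-1) 0 1 0 **
      mat3 1 1 1 0 0 1 1 0 0 = (mat 1 :: int ^ 3 ^ 3)"
      by (simp add: mat3_mult)
    show "act (mat3 0 0 1 1 (-1) (-1) 0 1 0) (vector [1, \<omega>, \<omega>'])
      = \<omega>' *\<^sub>R vector [1, \<omega>'' / \<omega>', 1 / (\<omega>' / \<omega>)]"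
      using sum nz unfolding act_mat3 by (simp add: vec_eq_iff forall_3)
  qed
  with equiv show "v 1 \<sim>\<^sub>v vector [1, \<omega>'' / \<omega>', 1 / (\<omega>' / \<omega>)]" by (rule vec_equiv_trans)
qed

text \<open>An element of norm \<open>1\<close> is a quotient \<open>\<tau>(h) / h\<close>, where \<open>\<tau>\<close> is the automorphism that takes \<open>\<omega>\<close> to
  \<open>\<omega>''\<close>. With \<open>1 / \<omega>' = \<omega> \<omega>''\<close> the sum \<open>h\<inverse> = 1 + \<omega> + \<omega> \<omega>''\<close> is the resolvent of Hilbert's Theorem 90
  that produces \<open>h\<close>; hence \<open>h\<close>, \<open>h \<omega>\<close>, \<open>h / \<omega>'\<close> are conjugate, and by the choice of \<open>h\<close> their sum
  is \<open>1\<close>.\<close>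
lemma equiv_norm_one_imp_trace_one:
  assumes cubic': "cubic_conjugates \<omega> \<omega>' \<omega>''" and equiv: "v 1 \<sim>\<^sub>v vector [1, \<omega>, 1 / \<omega>']"
    and prod: "\<omega> * \<omega>' * \<omega>'' = 1"
  defines "h \<equiv> inverse (1 + \<omega> + 1 / \<omega>')"
  shows "cubic_conjugates h (h * \<omega>) (h / \<omega>')"
    and "v 1 \<sim>\<^sub>v vector [1, h, h * \<omega>]"
    and "h + h * \<omega> + h / \<omega>' = 1"
proof -
  obtain X x y c where X: "X \<in> GL_int" and xy: "x \<in> K" "y \<in> K" "x 1 = \<omega>" "y 1 = 1 / \<omega>'"
    and c': "\<forall>i. c i \<noteq> 0" and Xv': "\<forall>i. act X (v i) = c i *\<^sub>R vector [1, x i, y i]"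
    using equiv by (rule vec_equivE)
  note c = c'[rule_format] and Xv = Xv'[rule_format]
  obtain d where d: "d \<noteq> 0" "\<omega>' = x (1 + d)" "\<omega>'' = x (1 + d + d)"
    using xy(1) cubic' xy(3) by (rule K_conjugates)
  have irr: "x 1 \<notin> \<rat>" using cubic' xy(3) unfolding cubic_conjugates_iff by simp
  have "inverse (y i) = x (i + d)" for i
    using K_rotate[OF xy(1) irr K_inverse[OF xy(2)] _ d(1)] xy(4) d(2) by simp
  hence y: "y i = inverse (x (i + d))" for i by (metis inverse_inverse_eq)
  have p: "x i * x (i + d) * x (i + d + d) = 1" for i
    using prod unfolding d(2,3) xy(3)[symmetric] by (metis prod3_shift[OF d(1)])
  have x0: "x i \<noteq> 0" for i using p[of i] by auto
  define Y :: "int ^ 3 ^ 3" where "Y = mat3 1 1 1 1 0 0 0 1 0"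
  define Y' :: "int ^ 3 ^ 3" where "Y' = mat3 0 1 0 0 0 1 1 (-1) (-1)"
  have Y: "Y ** Y' = mat 1" unfolding Y_def Y'_def
    by (simp add: mat3_mult)
  have s0: "1 + x i + y i \<noteq> 0" for i
  proof -
    have "act (Y ** X) (v i) $ 1 = c i * (1 + x i + y i)"
      unfolding act_mult Xv act_scaleR Y_def act_mat3 by simp
    thus ?thesis using GL_int_act_nonzero[OF GL_int_mult[OF GL_intI[OF Y] X], of i 1] by auto
  qed
  define g where "g i = inverse ((1 + x i) + y i)" for i
  have gK: "g \<in> K" unfolding g_def[abs_def] by (intro K_inverse K_add K_const xy) auto
  have g0: "g i \<noteq> 0" for i using s0[of i] by (simp add: g_def)
  have g1: "g 1 = h" unfolding g_def h_def xy ..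
  \<comment> \<open>The automorphism is the shift by \<open>d + d\<close>, which takes \<open>\<omega>\<close> to \<open>\<omega>''\<close>.\<close>
  have gx: "g (i + d + d) = g i * x i" for i
  proof -
    have yi: "y i = x i * x (i + d + d)" using p[of i] x0 unfolding y by (simp add: field_simps)
    have "y (i + d + d) = inverse (x i)" unfolding y add_thrice_3 ..
    hence "x i * (1 + x (i + d + d) + y (i + d + d)) = 1 + x i + y i"
      using x0[of i] unfolding yi by (simp add: field_simps)
    thus ?thesis using s0[of i] s0[of "i + d + d"] x0[of i] unfolding g_def by (simp add: field_simps)
  qed
  have "i + d + d + d + d = i + d" for i by (simp only: add_thrice_3)
  hence "g (1 + d) = g (1 + d + d) * x (1 + d + d)" using gx[of "1 + d + d"] by simp
  also have "\<dots> = h * (\<omega> * \<omega>'')" unfolding gx g1 xy d(3)[symmetric] by simp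
  also have "\<omega> * \<omega>'' = 1 / \<omega>'" using prod by (metis mult.commute mult.left_commute mult_zero_left nonzero_eq_divide_eq zero_neq_one)
  finally have g2: "g (1 + d) = h / \<omega>'" by simp
  have g3: "g (1 + d + d) = h * \<omega>" unfolding gx g1 xy ..
  have "g 1 \<notin> \<rat>"
  proof
    assume "g 1 \<in> \<rat>"
    hence "g (1 + d + d) = g 1" by (rule K_rational[OF gK])
    hence "\<omega> = 1" using g0[of 1] unfolding g3 g1 by simp
    thus False using irr xy by simp
  qed
  hence "cubic_conjugates (g 1) (g (1 + d)) (g (1 + d + d))"
    by (rule K_cubic_conjugates_shift[OF gK _ d(1)])
  hence "cubic_conjugates (h / \<omega>') (h * \<omega>) h"
    unfolding g1 g2 g3 by (rule cubic_conjugates_commute(2))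
  thus "cubic_conjugates h (h * \<omega>) (h / \<omega>')"
    using cubic_conjugates_commute by metis
  have h: "h * (1 + \<omega> + 1 / \<omega>') = 1" using s0[of 1] unfolding h_def xy by simp
  thus "h + h * \<omega> + h / \<omega>' = 1" by (simp add: algebra_simps)
  have "vector [1, \<omega>, 1 / \<omega>'] \<sim>\<^sub>v vector [1, h, h * \<omega>]"
  proof (rule vec_equivI[OF Y])
    have "h \<noteq> 0" using g0 g1 by metis
    thus "act Y (vector [1, \<omega>, 1 / \<omega>']) = (1 + \<omega> + 1 / \<omega>') *\<^sub>R vector [1, h, h * \<omega>]"
      using h unfolding Y_def act_mat3 by (simp add: vec_eq_iff forall_3 mult.commute mult.left_commute)
  qed
  with equiv show "v 1 \<sim>\<^sub>v vector [1, h, h * \<omega>]" by (rule vec_equiv_trans)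
qed

end

lemma vec_equiv_negate: "vector [1, a, b] \<sim>\<^sub>v vector [1, - a, b]"
proof (rule vec_equivI)
  show "mat3 1 0 0 0 (-1) 0 0 0 1 **
    mat3 1 0 0 0 (-1) 0 0 0 1 = (mat 1 :: int ^ 3 ^ 3)"
    by (simp add: mat3_mult)
  show "act (mat3 1 0 0 0 (-1) 0 0 0 1) (vector [1, a, b])
    = 1 *\<^sub>R vector [1, - a, b]"
    unfolding act_mat3 by (simp add: vec_eq_iff forall_3)
qed

lemma cubic_conjugates_uminus:
  "cubic_conjugates x y z \<Longrightarrow> cubic_conjugates (- x) (- y) (- z)"
  unfolding cubic_conjugates_iff
proof (elim conjE, intro conjI)
  assume "x + y + z \<in> \<rat>"
  moreover have "- x + - y + - z = - (x + y + z)" by simp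
  ultimately show "- x + - y + - z \<in> \<rat>" by (simp only: Rats_minus_iff)
qed simp_all

section \<open>Palindromic symmetries have order three up to sign\<close>
lemma fixpoint_free_permutation_3:
  fixes \<sigma> :: "3 \<Rightarrow> 3"
  assumes "\<sigma> permutes UNIV" "\<And>i. \<sigma> i \<noteq> i"
  obtains d where "d \<noteq> 0" "\<forall>i. \<sigma> i = i + d"
proof -
  have inj: "\<sigma> i = \<sigma> j \<Longrightarrow> i = j" for i j using permutes_inj[OF assms(1)] by (rule injD)
  have n: "(1::3) \<noteq> 2" "(1::3) \<noteq> 3" "(2::3) \<noteq> 3" by simp_all
  have "\<sigma> 1 = 2 \<and> \<sigma> 2 = 3 \<and> \<sigma> 3 = 1 \<or> \<sigma> 1 = 3 \<and> \<sigma> 2 = 1 \<and> \<sigma> 3 = 2"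
    using exhaust_3[of "\<sigma> 1"] exhaust_3[of "\<sigma> 2"] exhaust_3[of "\<sigma> 3"]
      assms(2)[of 1] assms(2)[of 2] assms(2)[of 3] inj[of 1 2] inj[of 1 3] inj[of 2 3] n by (elim disjE) simp_all
  thus ?thesis
  proof
    assume "\<sigma> 1 = 2 \<and> \<sigma> 2 = 3 \<and> \<sigma> 3 = 1"
    hence "\<sigma> i = i + 1" for i using exhaust_3[of i] by auto
    thus ?thesis using that[of 1] by simp
  next
    assume *: "\<sigma> 1 = 3 \<and> \<sigma> 2 = 1 \<and> \<sigma> 3 = 2"
    have "\<sigma> i = i + 2" for i using exhaust_3[of i] * by (auto simp: three_arith)
    thus ?thesis using that[of 2] by simp
  qed
qed

context algebraic_lines
begin

lemma v_inj: "v i = v j \<Longrightarrow> i = j"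
proof (rule ccontr)
  assume "v i = v j" "i \<noteq> j"
  hence "det (\<chi> i. v i) = 0" by (intro det_identical_rows[of i j]) (auto simp: row_def)
  thus False using v_det by simp
qed

lemma v_independent:
  assumes "a *\<^sub>R v i + b *\<^sub>R v j + c *\<^sub>R v k = 0" "i \<noteq> j" "j \<noteq> k" "i \<noteq> k"
  shows "a = 0"
proof -
  define f where "f = (\<lambda>h. if h = i then a else if h = j then b else c)"
  have U: "UNIV = {i, j, k}" 
    unfolding UNIV_3 using assms(2-4) exhaust_3[of i] exhaust_3[of j] exhaust_3[of k] by auto
  have "(\<Sum>h\<in>UNIV. f h *s row h (\<chi> i. v i)) = 0"
    unfolding U f_def using assms by (simp add: row_def scalar_mult_eq_scaleR add.assoc)
  moreover have "\<exists>B. (\<chi> i. v i) ** B = mat 1"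
    using v_det by (metis invertible_det_nz invertible_right_inverse)
  ultimately have "f i = 0" using matrix_right_invertible_independent_rows[THEN iffD1] by blast
  thus ?thesis by (simp add: f_def)
qed

lemma act_eqI:
  assumes "\<And>i. act X (v i) = q *\<^sub>R v i"
  shows "act X u = q *\<^sub>R u"
proof -
  have "(\<Sum>k\<in>UNIV. (real_of_int (X $ j $ k) - (if j = k then q else 0)) * v i $ k) = 0" for i j
    using arg_cong[OF assms[of i], of "\<lambda>w. w $ j"]
    by (simp add: act_nth left_diff_distrib sum_subtractf if_distrib[of "\<lambda>x. x * _"] cong: if_cong)
  hence "(\<chi> k. real_of_int (X $ j $ k) - (if j = k then q else 0)) = 0" for j
    by (intro real_row_zero) simp
  hence "real_of_int (X $ j $ k) = (if j = k then q else 0)" for j k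
    by (simp add: vec_eq_iff)
  thus ?thesis by (simp add: vec_eq_iff act_nth if_distrib[of "\<lambda>x. x * _"] cong: if_cong)
qed

text \<open>The \<open>v\<^sub>i\<close> span the space, so the matrix is scalar and the factor is one of its entries.\<close>
lemma act_scalar_Ints:
  assumes "\<And>i. act X (v i) = q *\<^sub>R v i"
  shows "q \<in> \<int>"
proof -
  have "act X (axis 1 1) $ 1 = q" unfolding act_eqI[OF assms] by (simp add: axis_def)
  moreover have "act X (axis 1 1) $ 1 \<in> \<int>"
    unfolding act_nth by (intro Ints_sum Ints_mult) (auto simp: axis_def)
  ultimately show ?thesis by simp
qed

text \<open>If \<open>\<sigma>\<close> fixed an index \<open>k\<close>, then \<open>G v\<^sub>k = c\<^sub>k v\<^sub>k\<close> would be an identity in the field, and its conjugates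
  would say that \<open>G\<close> fixes all three lines.\<close>
lemma palindromic_symmetry_shift:
  assumes l: "\<And>i. l i = span {v i}" and G: "palindromic_symmetry l G"
  obtains d c where "d \<noteq> 0" "\<forall>i. c i \<noteq> 0" "\<forall>i. act G (v i) = c i *\<^sub>R v (i + d)"
proof -
  obtain \<sigma> where GL: "G \<in> GL_int" and \<sigma>: "\<sigma> permutes UNIV" "\<And>i. act G ` l i = l (\<sigma> i)" "\<sigma> \<noteq> id"
    using G unfolding palindromic_symmetry_def symmetry_CF_def by blast
  define c where "c i = act G (v i) $ 1" for i
  have c: "c i \<noteq> 0" for i unfolding c_def by (rule GL_int_act_nonzero[OF GL])
  have cK: "c \<in> K" unfolding c_def[abs_def] act_nth_lin_form by (rule lin_form_K)
  have Gv: "act G (v i) = c i *\<^sub>R v (\<sigma> i)" for i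
  proof -
    have "act G (v i) \<in> l (\<sigma> i)" using \<sigma>(2)[of i] l[of i] span_base by blast
    then obtain k where k: "act G (v i) = k *\<^sub>R v (\<sigma> i)" unfolding l by (auto simp: span_singleton)
    have "c i = k" unfolding c_def k by (simp add: v_1)
    thus ?thesis using k by simp
  qed
  have "\<sigma> k \<noteq> k" for k
  proof
    assume k: "\<sigma> k = k"
    have "act G (v i) $ j = c i * v i $ j" for i j
    proof -
      have "(\<lambda>i. act G (v i) $ j - c i * v i $ j) \<in> K"
        unfolding act_nth_lin_form by (intro K_diff K_mult lin_form_K cK v_K)
      from K_zero[OF this, of k i] show ?thesis using Gv[of k] k by simp
    qed
    hence "c i *\<^sub>R v i = c i *\<^sub>R v (\<sigma> i)" for i unfolding Gv[symmetric] by (simp add: vec_eq_iff)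
    hence "v i = v (\<sigma> i)" for i using c by (metis scaleR_cancel_left)
    hence "\<sigma> i = i" for i using v_inj by metis
    thus False using \<sigma>(3) by auto
  qed
  then obtain d where "d \<noteq> 0" "\<forall>i. \<sigma> i = i + d" by (rule fixpoint_free_permutation_3[OF \<sigma>(1)])
  thus ?thesis using that[of d c] c Gv by simp
qed

text \<open>The cube of \<open>G\<close> multiplies each \<open>v\<^sub>i\<close> by the product of all the \<open>c\<^sub>i\<close>. So \<open>G\<^sup>3\<close> is a scalar matrix, and
  the scalar is an integer with an integral inverse. If it is \<open>-1\<close>, then \<open>- G\<close> has the cube \<open>1\<close>.\<close>
lemma palindromic_symmetry_cube_id:
  assumes l: "\<And>i. l i = span {v i}" and pal: "palindromic_CF l"
  obtains G d c where "d \<noteq> 0" "\<forall>i. c i \<noteq> 0" "\<forall>i. act G (v i) = c i *\<^sub>R v (i + d)"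
    "\<forall>i. c i * c (i + d) * c (i + d + d) = 1"
proof -
  obtain G where G: "palindromic_symmetry l G" using pal unfolding palindromic_CF_def ..
  hence GL: "G \<in> GL_int" unfolding palindromic_symmetry_def symmetry_CF_def by blast
  obtain d c where d: "d \<noteq> 0" and c': "\<forall>i. c i \<noteq> 0" 
    and Gv': "\<forall>i. act G (v i) = c i *\<^sub>R v (i + d)"
    using l G by (rule palindromic_symmetry_shift)
  note c = c'[rule_format] and Gv = Gv'[rule_format]
  define N where "N = c 1 * c 2 * c 3"
  have N: "c i * c (i + d) * c (i + d + d) = N" for i unfolding N_def by (rule prod3_shift[OF d])
  have N0: "N \<noteq> 0" unfolding N_def using c by simp
  have G3: "act (G ** G ** G) (v i) = N *\<^sub>R v i" for i
    unfolding act_mult Gv act_scaleR N[of i, symmetric] by (simp only: add_thrice_3 mult.assoc scaleR_scaleR)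
  obtain B where B: "G ** B = mat 1" "B ** G = mat 1" using GL by (rule GL_intE)
  have "act (B ** B ** B) (v i) = inverse N *\<^sub>R v i" for i
  proof -
    have "v i = inverse N *\<^sub>R act (G ** G ** G) (v i)" unfolding G3 using N0 by simp
    hence "act (B ** B ** B) (v i) = inverse N *\<^sub>R act (B ** B ** B) (act (G ** G ** G) (v i))"
      by (metis act_scaleR)
    thus ?thesis by (simp add: act_mult act_inverse[OF B(2)])
  qed
  hence "inverse N \<in> \<int>" by (rule act_scalar_Ints)
  moreover have "N \<in> \<int>" using G3 by (rule act_scalar_Ints)
  ultimately obtain a b where ab: "N = of_int a" "inverse N = of_int b" by (auto elim!: Ints_cases)
  hence "of_int (a * b) = (1::real)" using N0 by (metis of_int_mult right_inverse)
  hence "a * b = 1" by linarith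
  hence "a = 1 \<or> a = -1" by (metis zmult_eq_1_iff)
  thus ?thesis
  proof
    assume "a = 1"
    thus ?thesis using that[OF d c' Gv'] N ab by simp
  next
    assume a: "a = -1"
    have "act (- G) u = - act G u" for u by (simp add: vec_eq_iff act_nth sum_negf)
    hence "\<forall>i. act (- G) (v i) = (- c i) *\<^sub>R v (i + d)" using Gv by simp
    moreover have "\<forall>i. - c i * - c (i + d) * - c (i + d + d) = 1" using N ab a by simp
    ultimately show ?thesis using that[of d "\<lambda>i. - c i" "- G"] d c by simp
  qed
qed

end

section \<open>The lattice of linear forms under a symmetry of order three\<close>

text \<open>Half of the sum of the squared differences of the entries, so zero exactly for constant families. On the span of
  a family and its shift, modulo constants, it is up to a factor the norm form of the Eisenstein integers.\<close>
definition cyclic_norm :: "(3 \<Rightarrow> real) \<Rightarrow> real" where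
  "cyclic_norm x = x 1 * x 1 + x 2 * x 2 + x 3 * x 3 - x 1 * x 2 - x 2 * x 3 - x 3 * x 1"

lemma cyclic_norm_squares:
  "cyclic_norm x = ((x 1 - x 2)^2 + (x 2 - x 3)^2 + (x 3 - x 1)^2) / 2"
  by (simp add: cyclic_norm_def power2_eq_square field_simps)

lemma cyclic_norm_nonneg: "cyclic_norm x \<ge> 0"
  unfolding cyclic_norm_squares by simp

lemma cyclic_norm_eq_0_iff: "cyclic_norm x = 0 \<longleftrightarrow> (\<forall>i. x i = x 1)"
proof -
  have "cyclic_norm x = 0 \<longleftrightarrow> x 1 - x 2 = 0 \<and> x 2 - x 3 = 0 \<and> x 3 - x 1 = 0"
    unfolding cyclic_norm_squares by (simp add: add_nonneg_eq_0_iff)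
  also have "\<dots> \<longleftrightarrow> (\<forall>i. x i = x 1)" unfolding forall_3 by auto
  finally show ?thesis .
qed

text \<open>Multiplicativity of the norm: the norm of the Eisenstein integer with coordinates \<open>b\<close>, \<open>c\<close> splits off.\<close>
lemma cyclic_norm_combination:
  fixes d :: 3
  assumes "d \<noteq> 0"
  shows "cyclic_norm (\<lambda>i. a + b * x i + c * x (i + d)) = (b * b - b * c + c * c) * cyclic_norm x"
proof -
  have "cyclic_norm (\<lambda>i. a + b * x i + c * x (i + 1)) = (b * b - b * c + c * c) * cyclic_norm x"
    unfolding cyclic_norm_def by (simp add: three_arith) (simp add: algebra_simps)
  moreover have "cyclic_norm (\<lambda>i. a + b * x i + c * x (i + 2)) = (b * b - b * c + c * c) * cyclic_norm x"
    unfolding cyclic_norm_def by (simp add: three_arith) (simp add: algebra_simps)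
  moreover have "d = 1 \<or> d = 2" using assms exhaust_3[of d] by auto
  ultimately show ?thesis by (elim disjE) (simp_all only:)
qed

text \<open>Rounding both coordinates leaves a remainder of norm at most \<open>3/4\<close>; this is why the Eisenstein integers
  are Euclidean.\<close>
lemma eisenstein_form_bound:
  fixes b c :: real
  assumes "\<bar>b\<bar> \<le> 1/2" "\<bar>c\<bar> \<le> 1/2"
  shows "b * b - b * c + c * c < 1" and "b * b - b * c + c * c = 0 \<Longrightarrow> b = 0 \<and> c = 0"
proof -
  have "b * b \<le> 1/2 * (1/2)" "c * c \<le> 1/2 * (1/2)" "\<bar>b * c\<bar> \<le> 1/2 * (1/2)"
    using assms mult_mono[of "\<bar>b\<bar>" "1/2" "\<bar>b\<bar>" "1/2"] mult_mono[of "\<bar>c\<bar>" "1/2" "\<bar>c\<bar>" "1/2"]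
      mult_mono[of "\<bar>b\<bar>" "1/2" "\<bar>c\<bar>" "1/2"] by (simp_all add: abs_mult)
  thus "b * b - b * c + c * c < 1" by linarith
next
  assume "b * b - b * c + c * c = 0"
  hence "b\<^sup>2 + c\<^sup>2 + (b - c)\<^sup>2 = 0" by (simp add: power2_eq_square algebra_simps)
  thus "b = 0 \<and> c = 0" by (simp add: add_nonneg_eq_0_iff)
qed

text \<open>The equation for the factors \<open>c\<close> says that \<open>G\<^sup>3 = 1\<close>.\<close>
locale cyclic_symmetry = algebraic_lines m v for m v +
  fixes G :: "int ^ 3 ^ 3" and d :: 3 and c :: "3 \<Rightarrow> real"
  assumes d: "d \<noteq> 0" and c0: "c i \<noteq> 0"
    and Gv: "act G (v i) = c i *\<^sub>R v (i + d)"
    and cube: "c i * c (i + d) * c (i + d + d) = 1"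
begin

definition orbit_sum :: "int ^ 3 \<Rightarrow> int ^ 3" where
  "orbit_sum s = s + s v* G + (s v* G) v* G"

lemma lin_form_orbit: "lin_form (s v* G) (v i) = c i * lin_form s (v (i + d))"
  by (simp add: lin_form_vector_matrix Gv lin_form_scaleR)

lemma orbit_sum_fixed: "orbit_sum s v* G = orbit_sum s"
proof (rule lin_form_eqI)
  show "lin_form (orbit_sum s v* G) (v i) = lin_form (orbit_sum s) (v i)" for i
    unfolding lin_form_orbit unfolding orbit_sum_def lin_form_add lin_form_orbit add_thrice_3
    using cube[of i] by (simp add: distrib_left mult.assoc[symmetric])
qed

text \<open>The orbit sum of a coordinate form takes the value zero on \<open>v 1\<close> only if the
  corresponding coordinates of \<open>v 1\<close>, \<open>G v 1\<close>, \<open>G\<^sup>2 v 1\<close> cancel. This cannot be so for all coordinates, as these vectors are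
  independent.\<close>
lemma exists_fixed_row: "\<exists>r. r \<noteq> 0 \<and> r v* G = r"
proof (rule ccontr)
  assume "\<not> ?thesis"
  hence z: "orbit_sum s = 0" for s using orbit_sum_fixed by blast
  have "1 *\<^sub>R v 1 + c 1 *\<^sub>R v (1 + d) + (c 1 * c (1 + d)) *\<^sub>R v (1 + d + d) = 0"
  proof -
    have "v 1 $ j + c 1 * v (1 + d) $ j + c 1 * c (1 + d) * v (1 + d + d) $ j = 0" for j
    proof -
      have "lin_form (orbit_sum (axis j 1)) (v 1) = 0" unfolding z by (simp add: lin_form_def)
      thus ?thesis unfolding orbit_sum_def lin_form_add lin_form_orbit lin_form_axis by (simp add: mult.assoc)
    qed
    thus ?thesis by (simp add: vec_eq_iff)
  qed
  hence "(1::real) = 0"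
    by (rule v_independent) (use orbit_distinct_3[OF d] in auto)
  thus False by simp
qed

text \<open>A nonzero invariant row with the least sum of absolute values is primitive: if a
  nonintegral multiple of it were integral, so would be the multiple by the fractional part,
  which is smaller.\<close>
lemma exists_primitive_fixed_row:
  obtains r where "r \<noteq> 0" "r v* G = r" "\<forall>a::real. (\<forall>j. a * of_int (r $ j) \<in> \<int>) \<longrightarrow> a \<in> \<int>"
proof -
  define size where "size = (\<lambda>r :: int ^ 3. \<Sum>j\<in>UNIV. nat \<bar>r $ j\<bar>)"
  define P where "P r \<longleftrightarrow> r \<noteq> 0 \<and> r v* G = r" for r
  obtain r where r: "P r" and min: "\<And>s. P s \<Longrightarrow> size r \<le> size s"
    using ex_has_least_nat[of P _ size] exists_fixed_row unfolding P_def by metis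
  have size: "real (size s) = (\<Sum>j\<in>UNIV. \<bar>of_int (s $ j)\<bar>)" for s
    unfolding size_def by simp
  have "a \<in> \<int>" if a: "\<And>j. a * of_int (r $ j) \<in> \<int>" for a :: real
  proof (rule ccontr)
    assume "a \<notin> \<int>"
    define b where "b = frac a"
    have b: "0 < b" "b < 1" using \<open>a \<notin> \<int>\<close> by (auto simp: b_def frac_gt_0_iff frac_lt_1)
    have "b * of_int (r $ j) \<in> \<int>" for j
      using a[of j] unfolding b_def frac_def by (simp add: left_diff_distrib)
    hence s: "real_of_int \<lfloor>b * of_int (r $ j)\<rfloor> = b * of_int (r $ j)" for j
      by (metis Ints_cases floor_of_int)
    define t where "t = (\<chi> j. \<lfloor>b * real_of_int (r $ j)\<rfloor>)"
    have lt: "lin_form t u = b * lin_form r u" for u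
      unfolding lin_form_def t_def by (simp add: s sum_distrib_left mult.assoc)
    have "t \<noteq> 0"
    proof
      assume "t = 0"
      hence "lin_form r (v 1) = 0" using lt[of "v 1"] b by (simp add: lin_form_def)
      thus False using lin_form_zero r unfolding P_def by blast
    qed
    moreover have "t v* G = t"
    proof (rule lin_form_eqI)
      show "lin_form (t v* G) (v 1) = lin_form t (v 1)"
        using r unfolding P_def lin_form_vector_matrix lt by (metis lin_form_vector_matrix)
    qed
    ultimately have "size r \<le> size t" using min unfolding P_def by blast
    hence "real (size r) \<le> real (size t)" by simp
    also have "real (size t) = b * real (size r)"
      unfolding size t_def using b by (simp add: s abs_mult sum_distrib_left)
    finally have "real (size r) \<le> 0" using b by (simp add: mult_le_cancel_right1)
    hence "size r = 0" by simp
    hence "\<forall>j. r $ j = 0" by (simp add: size_def)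
    thus False using r unfolding P_def by (simp add: vec_eq_iff)
  qed
  thus ?thesis using that r unfolding P_def by blast
qed

end

locale cyclic_lattice = cyclic_symmetry m v G d c for m v G d c +
  fixes r :: "int ^ 3"
  assumes r0: "r \<noteq> 0" and rG: "r v* G = r"
    and primitive: "\<forall>a::real. (\<forall>j. a * of_int (r $ j) \<in> \<int>) \<longrightarrow> a \<in> \<int>"
begin

text \<open>Dividing by the invariant form rescales the \<open>v i\<close> to vectors that \<open>G\<close> permutes without factors, so that
  \<open>G\<close> acts on the values of the forms as a mere shift of the index (\<open>nform_rotate\<close> below).\<close>
definition nform :: "int ^ 3 \<Rightarrow> 3 \<Rightarrow> real" where
  "nform s i = lin_form s (v i) / lin_form r (v i)"

lemma lin_form_r: "lin_form r (v i) \<noteq> 0"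
  using lin_form_zero r0 by blast

lemma nform_K: "nform s \<in> K"
  unfolding nform_def[abs_def] by (intro K_divide lin_form_K)

lemma nform_r: "nform r i = 1" by (simp add: nform_def lin_form_r)
lemma nform_add: "nform (s + t) i = nform s i + nform t i" by (simp add: nform_def lin_form_add add_divide_distrib)
lemma nform_diff: "nform (s - t) i = nform s i - nform t i" by (simp add: nform_def lin_form_diff diff_divide_distrib)
lemma nform_smult: "nform (k *s s) i = of_int k * nform s i" by (simp add: nform_def lin_form_smult)

lemma nform_rotate: "nform (s v* G) i = nform s (i + d)"
proof -
  have "lin_form r (v i) = c i * lin_form r (v (i + d))" using lin_form_orbit[of r i] rG by simp
  thus ?thesis using c0[of i] by (simp add: nform_def lin_form_orbit)
qed

text \<open>A form whose normalised values agree is a multiple of \<open>r\<close>, and \<open>r\<close> is primitive.\<close>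
lemma nform_const:
  assumes "\<And>i. nform s i = q"
  shows "q \<in> \<int>"
proof -
  have "(\<Sum>j\<in>UNIV. (of_int (s $ j) - q * of_int (r $ j)) * v i $ j) = 0" for i
  proof -
    have "lin_form s (v i) = q * lin_form r (v i)" using assms[of i] lin_form_r[of i] by (simp add: nform_def field_simps)
    thus ?thesis unfolding lin_form_def by (simp add: left_diff_distrib sum_subtractf sum_distrib_left mult.assoc)
  qed
  hence "(\<chi> j. of_int (s $ j) - q * of_int (r $ j)) = 0" by (intro real_row_zero) simp
  hence "q * of_int (r $ j) = of_int (s $ j)" for j by (simp add: vec_eq_iff)
  hence "\<forall>j. q * of_int (r $ j) \<in> \<int>" by simp
  thus ?thesis using primitive by blast
qed

definition rotation_matrix :: "int ^ 3 \<Rightarrow> int ^ 3 ^ 3" where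
  "rotation_matrix s = vector [r, s, s v* G]"

text \<open>The determinant measures the index of the lattice spanned by \<open>r\<close>, \<open>s\<close>, \<open>s G\<close>. Evaluating
  these three forms on the rescaled vectors gives the rows \<open>(1, 1, 1)\<close>, \<open>x\<close> and \<open>x\<close> shifted, whose determinant
  is \<open>\<plusminus>\<close> the norm of \<open>x\<close>. Thus the norm is a fixed multiple of an integer, which makes descent on it possible.\<close>
lemma det_rotation_matrix:
  obtains \<kappa> where "\<kappa> > 0" "\<forall>s. \<bar>of_int (det (rotation_matrix s))\<bar> * \<kappa> = cyclic_norm (nform s)"
proof
  define W :: "real ^ 3 ^ 3" where "W = (\<chi> j i. v i $ j / lin_form r (v i))"
  have "W = transpose (\<chi> i. inverse (lin_form r (v i)) *s v i)"
    by (simp add: W_def transpose_def vec_eq_iff divide_inverse mult.commute)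
  hence "det W = prod (\<lambda>i. inverse (lin_form r (v i))) UNIV * det (\<chi> i. v i)"
    by (simp add: det_transpose det_rows_mul)
  hence "det W \<noteq> 0" using v_det lin_form_r by (simp add: prod_zero_iff)
  thus "\<bar>det W\<bar> > 0" by simp
  show "\<forall>s. \<bar>of_int (det (rotation_matrix s))\<bar> * \<bar>det W\<bar> = cyclic_norm (nform s)"
  proof
    fix s
    have rd: "real_of_int (det M) = det (map_matrix real_of_int M)" for M :: "int ^ 3 ^ 3"
      by (simp add: det_3 map_matrix_def)
    have nth: "(map_matrix real_of_int (rotation_matrix s) ** W) $ a $ i = nform (rotation_matrix s $ a) i" for a i
      by (simp add: matrix_matrix_mult_def map_matrix_def W_def nform_def lin_form_def sum_divide_distrib)
    have rows: "rotation_matrix s $ 1 = r" "rotation_matrix s $ 2 = s" "rotation_matrix s $ 3 = s v* G"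
      by (simp_all add: rotation_matrix_def)
    have "of_int (det (rotation_matrix s)) * det W = det (map_matrix real_of_int (rotation_matrix s) ** W)"
      by (simp add: det_mul rd)
    also have "\<bar>\<dots>\<bar> = cyclic_norm (nform s)"
    proof -
      have *: "det (map_matrix real_of_int (rotation_matrix s) ** W) = 
        nform s 2 * nform s (3 + d) + nform s 3 * nform s (1 + d) + nform s 1 * nform s (2 + d)
        - nform s 2 * nform s (1 + d) - nform s 1 * nform s (3 + d) - nform s 3 * nform s (2 + d)"
        unfolding det_3 nth rows nform_r nform_rotate by simp
      have "det (map_matrix real_of_int (rotation_matrix s) ** W) \<in> {cyclic_norm (nform s), - cyclic_norm (nform s)}"
        unfolding * using d exhaust_3[of d]
        by (auto simp: cyclic_norm_def three_arith algebra_simps)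
      thus ?thesis using cyclic_norm_nonneg[of "nform s"] by auto
    qed
    finally show "\<bar>of_int (det (rotation_matrix s))\<bar> * \<bar>det W\<bar> = cyclic_norm (nform s)"
      by (simp add: abs_mult)
  qed
qed

lemma exists_nonconstant: "\<exists>s. cyclic_norm (nform s) \<noteq> 0"
proof (rule ccontr)
  assume "\<not> ?thesis"
  hence const: "nform s i = nform s 1" for s i using cyclic_norm_eq_0_iff by blast
  have "v 2 $ j = v 1 $ j" for j
  proof -
    have *: "v 2 $ k / lin_form r (v 2) = v 1 $ k / lin_form r (v 1)" for k
      using const[of "axis k 1" 2] by (simp add: nform_def lin_form_axis)
    have "lin_form r (v 2) = lin_form r (v 1)" using *[of 1] by (simp add: v_1)
    thus ?thesis using *[of j] lin_form_r by simp
  qed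
  hence "v 2 = v 1" by (simp add: vec_eq_iff)
  thus False using v_inj[of 2 1] by simp
qed

text \<open>Take \<open>u\<close> of least nonzero norm. If a coordinate form \<open>y\<^sub>1 r + y\<^sub>2 u + y\<^sub>3 u G\<close> had a nonintegral
  coefficient \<open>y\<^sub>2\<close> or \<open>y\<^sub>3\<close>, subtracting the nearest integral combination of \<open>u\<close> and \<open>u G\<close> would leave
  a form of smaller nonzero norm. Once these two are integral, so is \<open>y\<^sub>1\<close>, because \<open>r\<close> is primitive. So the inverse of the matrix with
  rows \<open>r\<close>, \<open>u\<close>, \<open>u G\<close> is integral.\<close>
lemma exists_rotation_basis: "\<exists>u. rotation_matrix u \<in> GL_int \<and> cyclic_norm (nform u) \<noteq> 0"
proof -
  obtain \<kappa> where \<kappa>: "\<kappa> > 0" "\<forall>s. \<bar>of_int (det (rotation_matrix s))\<bar> * \<kappa> = cyclic_norm (nform s)"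
    by (rule det_rotation_matrix)
  obtain u where u: "cyclic_norm (nform u) \<noteq> 0"
    and min: "\<And>s. cyclic_norm (nform s) \<noteq> 0 \<Longrightarrow>
      nat \<bar>det (rotation_matrix u)\<bar> \<le> nat \<bar>det (rotation_matrix s)\<bar>"
    using ex_has_least_nat[of "\<lambda>s. cyclic_norm (nform s) \<noteq> 0" _ "\<lambda>s. nat \<bar>det (rotation_matrix s)\<bar>"]
      exists_nonconstant by metis
  have min': "cyclic_norm (nform u) \<le> cyclic_norm (nform s)" if "cyclic_norm (nform s) \<noteq> 0" for s
  proof -
    have "\<bar>det (rotation_matrix u)\<bar> \<le> \<bar>det (rotation_matrix s)\<bar>" using min[OF that] by linarith
    hence "\<bar>real_of_int (det (rotation_matrix u))\<bar> \<le> \<bar>of_int (det (rotation_matrix s))\<bar>"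
      by (metis of_int_abs of_int_le_iff)
    thus ?thesis using \<kappa> by (metis mult_right_mono less_imp_le)
  qed
  define X where "X = map_matrix real_of_int (rotation_matrix u)"
  have "det X = of_int (det (rotation_matrix u))"
    by (simp add: X_def det_3 map_matrix_def)
  hence "det X \<noteq> 0" using \<kappa>(2)[rule_format, of u] u by auto
  then obtain Y where Y: "Y ** X = mat 1" using invertible_det_nz invertible_left_inverse by metis
  have "Y $ j $ k \<in> \<int>" for j k
  proof -
    define y where "y = (\<lambda>k. Y $ j $ k)"
    define b where "b = y 2 - of_int (round (y 2))"
    define e where "e = y 3 - of_int (round (y 3))"
    define t where "t = axis j 1 - round (y 2) *s u - round (y 3) *s (u v* G)"
    have be: "\<bar>b\<bar> \<le> 1/2" "\<bar>e\<bar> \<le> 1/2"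
      using of_int_round_abs_le[of "y 2"] of_int_round_abs_le[of "y 3"] by (simp_all add: b_def e_def abs_minus_commute)
    have row: "real_of_int (axis j 1 $ i) = y 1 * of_int (r $ i) + y 2 * of_int (u $ i) + y 3 * of_int ((u v* G) $ i)" for i
    proof -
      have "real_of_int (axis j 1 $ i) = (Y ** X) $ j $ i" unfolding Y by (simp add: axis_def mat_def)
      also have "\<dots> = y 1 * of_int (r $ i) + y 2 * of_int (u $ i) + y 3 * of_int ((u v* G) $ i)"
        by (simp add: matrix_matrix_mult_def X_def map_matrix_def rotation_matrix_def y_def sum_3)
      finally show ?thesis .
    qed
    have "lin_form (axis j 1) z = y 1 * lin_form r z + y 2 * lin_form u z + y 3 * lin_form (u v* G) z" for z
      unfolding lin_form_def row by (simp add: distrib_right sum.distrib sum_distrib_left mult.assoc)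
    hence "nform (axis j 1) i = y 1 + y 2 * nform u i + y 3 * nform u (i + d)" for i
      unfolding nform_rotate[symmetric] unfolding nform_def using lin_form_r[of i] by (simp add: field_simps)
    hence pt: "nform t i = y 1 + b * nform u i + e * nform u (i + d)" for i
      unfolding t_def nform_diff nform_smult nform_rotate b_def e_def by (simp add: algebra_simps)
    have nt: "cyclic_norm (nform t) = (b * b - b * e + e * e) * cyclic_norm (nform u)"
      unfolding pt[abs_def] by (rule cyclic_norm_combination[OF d])
    have "cyclic_norm (nform u) > 0" using u cyclic_norm_nonneg[of "nform u"] by simp
    hence "cyclic_norm (nform t) < cyclic_norm (nform u)"
      using eisenstein_form_bound(1)[OF be] nt by simp
    hence "cyclic_norm (nform t) = 0" using min'[of t] by linarith
    hence "b * b - b * e + e * e = 0" using nt u by simp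
    hence be0: "b = 0" "e = 0" using eisenstein_form_bound(2)[OF be] by auto
    hence "nform t i = y 1" for i using pt by simp
    hence "y 1 \<in> \<int>" by (rule nform_const)
    moreover have "y 2 \<in> \<int>" "y 3 \<in> \<int>" using be0 unfolding b_def e_def by (metis Ints_of_int eq_iff_diff_eq_0)+
    ultimately show ?thesis using exhaust_3[of k] unfolding y_def by auto
  qed
  hence Z: "real_of_int \<lfloor>Y $ j $ k\<rfloor> = Y $ j $ k" for j k by (metis Ints_cases floor_of_int)
  define Z where "Z = (\<chi> j k. \<lfloor>Y $ j $ k\<rfloor>)"
  have "Y = map_matrix real_of_int Z" by (simp add: vec_eq_iff map_matrix_def Z_def Z)
  hence "map_matrix real_of_int (Z ** rotation_matrix u) = map_matrix real_of_int (mat 1)"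
    using Y unfolding X_def map_matrix_mult map_matrix_mat_1 by simp
  hence "Z ** rotation_matrix u = mat 1" by (simp add: vec_eq_iff map_matrix_def)
  hence "rotation_matrix u \<in> GL_int" using GL_intI int_left_inverse_commute by blast
  thus ?thesis using u by blast
qed

text \<open>The trace \<open>S\<close> of \<open>u\<close> is the value of its orbit sum, a multiple of \<open>r\<close>, hence an integer.\<close>
lemma exists_equiv_conjugates:
  "\<exists>\<omega> \<omega>' \<omega>''. cubic_conjugates \<omega> \<omega>' \<omega>'' \<and> v 1 \<sim>\<^sub>v vector [1, \<omega>, \<omega>'] \<and> 
     (\<omega> + \<omega>' + \<omega>'' = 0 \<or> \<omega> + \<omega>' + \<omega>'' = 1)"
proof -
  obtain u where u: "rotation_matrix u \<in> GL_int" "cyclic_norm (nform u) \<noteq> 0"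
    using exists_rotation_basis by blast
  have "act (rotation_matrix u) (v 1) = lin_form r (v 1) *\<^sub>R vector [1, nform u 1, nform u (1 + d)]"
    unfolding nform_rotate[symmetric] using lin_form_r[of 1]
    by (simp add: vec_eq_iff forall_3 act_nth_lin_form rotation_matrix_def nform_def)
  hence equiv: "v 1 \<sim>\<^sub>v vector [1, nform u 1, nform u (1 + d)]"
    unfolding vec_equiv_def using u(1) v_1 by auto
  have "nform (orbit_sum u) i = nform u 1 + nform u 2 + nform u 3" for i
    unfolding orbit_sum_def nform_add nform_rotate by (rule sum3_shift[OF d])
  hence "nform u 1 + nform u 2 + nform u 3 \<in> \<int>" by (rule nform_const)
  then obtain S where S: "nform u 1 + nform u 2 + nform u 3 = of_int S" by (auto elim: Ints_cases)
  have irr: "nform u 1 \<notin> \<rat>"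
    using K_rational[OF nform_K, of u 1] u(2) cyclic_norm_eq_0_iff by blast
  \<comment> \<open>The trace of \<open>\<plusminus>u + n r\<close> is \<open>\<plusminus>S + 3n\<close>; the sign turns the residue \<open>2\<close> into \<open>1\<close>.\<close>
  obtain e n k :: int where e: "e * e = 1" and k: "e * S + 3 * n = k" "k = 0 \<or> k = 1"
  proof -
    have S3: "S = 3 * (S div 3) + S mod 3" by simp
    consider "S mod 3 = 0" | "S mod 3 = 1" | "S mod 3 = 2" by linarith
    thus ?thesis
    proof cases
      case 1
      thus ?thesis using S3 by (intro that[of 1 "- (S div 3)" 0]) simp_all
    next
      case 2
      thus ?thesis using S3 by (intro that[of 1 "- (S div 3)" 1]) simp_all
    next
      case 3
      thus ?thesis using S3 by (intro that[of "-1" "S div 3 + 1" 1]) simp_all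
    qed
  qed
  define x where "x i = of_int n + of_int e * nform u i" for i
  have xK: "x \<in> K" unfolding x_def[abs_def] by (intro K_add K_scale K_const nform_K) auto
  have e2: "of_int e * of_int e = (1::real)" using e by (metis of_int_1 of_int_mult)
  have "x 1 \<notin> \<rat>"
  proof
    assume "x 1 \<in> \<rat>"
    hence "of_int e * (x 1 - of_int n) \<in> \<rat>" by auto
    also have "of_int e * (x 1 - of_int n) = nform u 1" unfolding x_def using e2 by (simp add: mult.assoc[symmetric])
    finally show False using irr by simp
  qed
  hence "cubic_conjugates (x 1) (x (1 + d)) (x (1 + d + d))"
    by (rule K_cubic_conjugates_shift[OF xK _ d])
  moreover have "x 1 + x (1 + d) + x (1 + d + d) = of_int k"
  proof -
    have "x 1 + x (1 + d) + x (1 + d + d) = x 1 + x 2 + x 3" by (rule sum3_shift[OF d])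
    also have "\<dots> = of_int e * (nform u 1 + nform u 2 + nform u 3) + 3 * of_int n" by (simp add: x_def algebra_simps)
    also have "\<dots> = of_int k" unfolding S k(1)[symmetric] by simp
    finally show ?thesis .
  qed
  moreover have "v 1 \<sim>\<^sub>v vector [1, x 1, x (1 + d)]"
  proof -
    have "vector [1, nform u 1, nform u (1 + d)] \<sim>\<^sub>v vector [1, x 1, x (1 + d)]"
    proof (rule vec_equivI)
      show "mat3 1 0 0 n e 0 n 0 e ** mat3 1 0 0 (- e * n) e 0 (- e * n) 0 e = mat 1"
        unfolding mat3_mult using e by (simp add: mult.assoc[symmetric])
      show "act (mat3 1 0 0 n e 0 n 0 e) (vector [1, nform u 1, nform u (1 + d)]) = 1 *\<^sub>R vector [1, x 1, x (1 + d)]"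
        unfolding act_mat3 by (simp add: x_def vec_eq_iff forall_3)
    qed
    with equiv show ?thesis by (rule vec_equiv_trans)
  qed
  ultimately show ?thesis using k(2) by (metis of_int_0 of_int_1)
qed

end

section \<open>The characterisation of palindromic continued fractions\<close>
context algebraic_lines
begin

lemma palindromic_imp_equiv:
  assumes l: "\<And>i. l i = span {v i}" and pal: "palindromic_CF l"
  shows "\<exists>\<omega> \<omega>' \<omega>''. cubic_conjugates \<omega> \<omega>' \<omega>'' \<and> v 1 \<sim>\<^sub>v vector [1, \<omega>, \<omega>'] \<and>
     (\<omega> + \<omega>' + \<omega>'' = 0 \<or> \<omega> + \<omega>' + \<omega>'' = 1)"
proof -
  obtain G d c where G: "d \<noteq> 0" "\<forall>i. c i \<noteq> 0" "\<forall>i. act G (v i) = c i *\<^sub>R v (i + d)"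
    "\<forall>i. c i * c (i + d) * c (i + d + d) = 1"
    using l pal by (rule palindromic_symmetry_cube_id)
  interpret cyclic_symmetry m v G d c by unfold_locales (use G in blast)+
  obtain r where "r \<noteq> 0" "r v* G = r" "\<forall>a::real. (\<forall>j. a * of_int (r $ j) \<in> \<int>) \<longrightarrow> a \<in> \<int>"
    by (rule exists_primitive_fixed_row)
  then interpret cyclic_lattice m v G d c r by unfold_locales blast+
  show ?thesis by (rule exists_equiv_conjugates)
qed

end

theorem mainTheorem1:
  fixes l :: "3 \<Rightarrow> (real ^ 3) set" and \<alpha> \<beta> :: real
  assumes "algebraic_CF l"
    and "l 1 = span {vector [1, \<alpha>, \<beta>]}"
  shows "(palindromic_CF l \<longleftrightarrow>
            (\<exists>\<omega> \<omega>' \<omega>''. cubic_conjugates \<omega> \<omega>' \<omega>'' \<and>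
               (vector [1, \<alpha>, \<beta>] \<sim>\<^sub>v vector [1, \<omega>, \<omega>'] \<and> \<omega> + \<omega>' + \<omega>'' = 0 \<or>
                vector [1, \<alpha>, \<beta>] \<sim>\<^sub>v vector [1, \<omega>, \<omega>'] \<and> \<omega> + \<omega>' + \<omega>'' = 1)))
       \<and> ((\<exists>\<omega> \<omega>' \<omega>''. cubic_conjugates \<omega> \<omega>' \<omega>'' \<and>
               vector [1, \<alpha>, \<beta>] \<sim>\<^sub>v vector [1, \<omega>, \<omega>'] \<and> \<omega> + \<omega>' + \<omega>'' = 1)
          \<longleftrightarrow> (\<exists>\<omega> \<omega>' \<omega>''. cubic_conjugates \<omega> \<omega>' \<omega>'' \<and>
               vector [1, \<alpha>, \<beta>] \<sim>\<^sub>v vector [1, \<omega>, 1 / \<omega>'] \<and> \<omega> * \<omega>' * \<omega>'' = 1))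
       \<and> ((\<exists>\<omega> \<omega>' \<omega>''. cubic_conjugates \<omega> \<omega>' \<omega>'' \<and>
               vector [1, \<alpha>, \<beta>] \<sim>\<^sub>v vector [1, \<omega>, \<omega>'] \<and> \<omega> + \<omega>' + \<omega>'' = 1)
          \<longleftrightarrow> (\<exists>\<omega> \<omega>' \<omega>''. cubic_conjugates \<omega> \<omega>' \<omega>'' \<and>
               vector [1, \<alpha>, \<beta>] \<sim>\<^sub>v vector [1, \<omega>, - 1 / \<omega>'] \<and> \<omega> * \<omega>' * \<omega>'' = - 1))"
proof -
  obtain m v where av: "algebraic_lines m v" and l': "\<forall>i. l i = span {v i}"
    and v1: "v 1 = vector [1, \<alpha>, \<beta>]"
    using assms by (rule algebraic_CF_imp_algebraic_lines)
  note l = l'[rule_format]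
  interpret algebraic_lines m v by (rule av)
  let ?b = "\<lambda>x y z. cubic_conjugates x y z \<and> v 1 \<sim>\<^sub>v vector [1, x, y] \<and> x + y + z = 1"
  let ?c = "\<lambda>x y z. cubic_conjugates x y z \<and> v 1 \<sim>\<^sub>v vector [1, x, 1 / y] \<and> x * y * z = 1"
  let ?d = "\<lambda>x y z. cubic_conjugates x y z \<and> v 1 \<sim>\<^sub>v vector [1, x, - 1 / y] \<and> x * y * z = - 1"
  have ab: "palindromic_CF l \<longleftrightarrow> (\<exists>x y z. cubic_conjugates x y z \<and>
    (v 1 \<sim>\<^sub>v vector [1, x, y] \<and> x + y + z = 0 \<or> v 1 \<sim>\<^sub>v vector [1, x, y] \<and> x + y + z = 1))"
  proof
    assume "palindromic_CF l"
    from palindromic_imp_equiv[OF l this] show "\<exists>x y z. cubic_conjugates x y z \<and>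
      (v 1 \<sim>\<^sub>v vector [1, x, y] \<and> x + y + z = 0 \<or> v 1 \<sim>\<^sub>v vector [1, x, y] \<and> x + y + z = 1)"
      by blast
  next
    assume "\<exists>x y z. cubic_conjugates x y z \<and>
      (v 1 \<sim>\<^sub>v vector [1, x, y] \<and> x + y + z = 0 \<or> v 1 \<sim>\<^sub>v vector [1, x, y] \<and> x + y + z = 1)"
    then obtain x y z where xyz: "cubic_conjugates x y z" "v 1 \<sim>\<^sub>v vector [1, x, y]"
      "x + y + z = of_int 0 \<or> x + y + z = of_int 1"
      by (metis of_int_0 of_int_1)
    thus "palindromic_CF l" using palindromic_CF_if_equiv[OF l xyz(1,2)] by metis
  qed
  have bc: "(\<exists>x y z. ?b x y z) \<longleftrightarrow> (\<exists>x y z. ?c x y z)"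
    using equiv_trace_one_imp_norm_one equiv_norm_one_imp_trace_one by meson
  have cd: "?d (- x) (- y) (- z)" if "?c x y z" for x y z
    using that cubic_conjugates_uminus[of x y z] vec_equiv_trans[OF _ vec_equiv_negate, of "v 1" x "1 / y"]
    by simp
  have dc: "?c (- x) (- y) (- z)" if "?d x y z" for x y z
    using that cubic_conjugates_uminus[of x y z] vec_equiv_trans[OF _ vec_equiv_negate, of "v 1" x "- 1 / y"]
    by simp
  have "(\<exists>x y z. ?c x y z) \<longleftrightarrow> (\<exists>x y z. ?d x y z)" using cd dc by blast
  with ab bc show ?thesis unfolding v1 by simp
qed

end
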